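(* Let $f,g,c$ satisfy the standing assumption on the composite problem (P), $\min_x\Phi(x)=f(x)+g(c(x))$. Let all minimizers of (P) be nonstationary, and let the value function $\mathcal V(u)=\inf_x\{f(x)+g(c(x)-u)\}$, $u\in\mathbb R^m$, be proper and lower semicontinuous. Let $\{(x^k,z^k,y^k,\hat y^k)\}$ be a sequence generated by the safeguarded augmented Lagrangian method (described in the context) such that $\sum_{k=0}^\infty\sqrt{\varepsilon_k/\mu_k}<\infty$. Let $\mu\ge0$ be the limit of the nonincreasing sequence $\{\mu_k\}$. Then the following assertions hold. (i) If $\mu=0$, then $\|y^k\|\to\infty$ and $\limsup_{k\to\infty}(f(x^k)+g(z^k))\le\Phi^\star$. Particularly, each accumulation point $\bar x\in\mathbb R^n$ of $\{x^k\}$ is a minimizer of (P). For each subsequence $\{x^k\}_{k\in K}$ ($K\subseteq\mathbb N$ infinite) converging to some $\bar x$, one has $z^k\to c(\bar x)$ and $f(x^k)+g(z^k)\to\Phi^\star$ as $k\to\infty$, $k\in K$. (ii) If $\mu>0$, then $\{y^k\}$ converges to a solution of the problem $\text{minimize}_{y\in\mathbb R^m}\ -d(y)+\frac\mu2\operatorname{dist}_S^2(y)$, where $d$ is the Lagrange dual function of (P).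
   Context: Spaces $\mathbb R^n,\mathbb R^m$ carry the Euclidean inner product $\langle\cdot,\cdot\rangle$ and norm $\|\cdot\|$; $\overline{\mathbb R}=\mathbb R\cup\{+\infty\}$. For a proper lsc convex $g:\mathbb R^m\to\overline{\mathbb R}$, the horizon is $\operatorname{hzn} g=\{v\in\mathbb R^m : g(z+v)\le g(z)\ \forall z\in\operatorname{dom} g\}$ and $g^*$ is the convex conjugate. Standing assumption: $f:\mathbb R^n\to\mathbb R$ is continuously differentiable and convex; $g:\mathbb R^m\to\overline{\mathbb R}$ is proper, lsc, convex; $c:\mathbb R^n\to\mathbb R^m$ is continuously differentiable and $(-\operatorname{hzn} g)$-convex, i.e. $c(\lambda x+(1-\lambda)x')-\lambda c(x)-(1-\lambda)c(x')\in\operatorname{hzn} g$ for all $x,x'\in\mathbb R^n$, $\lambda\in[0,1]$; (P) is feasible and possesses a minimizer, with minimal value $\Phi^\star$. A feasible point $\bar x$ is stationary if there is $\bar y\in\partial g(c(\bar x))$ with $\nabla f(\bar x)+c'(\bar x)^\top\bar y=0$; otherwise it is nonstationary. Lagrangian: $L(x,y)=f(x)+\langle y,c(x)\rangle-g^*(y)$. Dual function: $d(y)=\inf_xL(x,y)\in\mathbb R\cup\{-\infty\}$. Augmented Lagrangian for $\mu>0$: $L_\mu(x,y)=f(x)+g^\mu(c(x)+\mu y)-\frac\mu2\|y\|^2$, where $g^\mu(z)=\inf_w\{g(w)+\frac1{2\mu}\|w-z\|^2\}$. $\operatorname{prox}_\varphi(z)$ is the unique minimizer of $w\mapsto\varphi(w)+\frac12\|w-z\|^2$;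 $\operatorname{proj}_S$ and $\operatorname{dist}_S$ are the Euclidean projection onto and distance to $S$. Safeguarded ALM. Data: $y^0\in\mathbb R^m$; $\mu_0>0$; nonempty, convex, compact set $S\subseteq\mathbb R^m$; $\beta\in(0,1)$. For $k=0,1,2,\dots$: set $\hat y^k=\operatorname{proj}_S(y^k)$; select $\varepsilon_k\ge0$ and $x^k\in\mathbb R^n$ with $L_{\mu_k}(x^k,\hat y^k)\le\inf_xL_{\mu_k}(x,\hat y^k)+\varepsilon_k$; set $z^k=\operatorname{prox}_{\mu_kg}(c(x^k)+\mu_k\hat y^k)$; set $y^{k+1}=\hat y^k+\mu_k^{-1}(c(x^k)-z^k)$; set $\mu_{k+1}=\beta_k\mu_k$ for some $\beta_k\in(0,\beta]\cup\{1\}$. *)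

theory Defs
  imports "HOL-Analysis.Analysis"
begin

text \<open>
  Extended-real-valued functions have type \<open>'a \<Rightarrow> ereal\<close>. A codomain of the form
  \<open>\<real> \<union> {\<infinity>}\<close> is expressed through \<open>proper_fun\<close>, which excludes the value \<open>-\<infinity>\<close>.
\<close>

definition edom :: "('a \<Rightarrow> ereal) \<Rightarrow> 'a set" where
  "edom \<phi> = {z. \<phi> z < \<infinity>}"

definition proper_fun :: "('a \<Rightarrow> ereal) \<Rightarrow> bool" where
  "proper_fun \<phi> \<longleftrightarrow> (\<forall>z. \<phi> z \<noteq> -\<infinity>) \<and> edom \<phi> \<noteq> {}"

definition lsc_fun :: "('a::topological_space \<Rightarrow> ereal) \<Rightarrow> bool" where
  "lsc_fun \<phi> \<longleftrightarrow> (\<forall>z. \<phi> z \<le> Liminf (at z) \<phi>)"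

text \<open>
  This is used for functions that avoid \<open>-\<infinity>\<close> only, so the sum on the right-hand side is
  never of the form \<open>\<infinity> - \<infinity>\<close>; moreover \<open>0 * \<infinity> = 0\<close> in \<open>ereal\<close>.
\<close>
definition convex_fun :: "('a::real_vector \<Rightarrow> ereal) \<Rightarrow> bool" where
  "convex_fun \<phi> \<longleftrightarrow> (\<forall>z w. \<forall>t\<in>{0..1}.
     \<phi> (t *\<^sub>R z + (1 - t) *\<^sub>R w) \<le> ereal t * \<phi> z + ereal (1 - t) * \<phi> w)"

text \<open>A minimizer is required to be feasible, i.e.\ to have a value below \<open>\<infinity>\<close>.\<close>
definition minimizer :: "('a \<Rightarrow> ereal) \<Rightarrow> 'a \<Rightarrow> bool" where
  "minimizer \<phi> z \<longleftrightarrow> z \<in> edom \<phi> \<and> (\<forall>w. \<phi> z \<le> \<phi> w)"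

definition hzn :: "('a::real_vector \<Rightarrow> ereal) \<Rightarrow> 'a set" where
  "hzn g = {v. \<forall>z\<in>edom g. g (z + v) \<le> g z}"

definition neg_hzn_convex :: "('b::real_vector \<Rightarrow> ereal) \<Rightarrow> ('a::real_vector \<Rightarrow> 'b) \<Rightarrow> bool" where
  "neg_hzn_convex g c \<longleftrightarrow> (\<forall>x x'. \<forall>t\<in>{0..1}.
     c (t *\<^sub>R x + (1 - t) *\<^sub>R x') - t *\<^sub>R c x - (1 - t) *\<^sub>R c x' \<in> hzn g)"

definition conjugate_fun :: "('a::real_inner \<Rightarrow> ereal) \<Rightarrow> 'a \<Rightarrow> ereal" where
  "conjugate_fun g y = (SUP z. ereal (y \<bullet> z) - g z)"

definition subdiff :: "('a::real_inner \<Rightarrow> ereal) \<Rightarrow> 'a \<Rightarrow> 'a set" where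
  "subdiff g z = {y. z \<in> edom g \<and> (\<forall>w. g z + ereal (y \<bullet> (w - z)) \<le> g w)}"

definition prox :: "('a::real_normed_vector \<Rightarrow> ereal) \<Rightarrow> 'a \<Rightarrow> 'a" where
  "prox \<phi> z = (THE p. minimizer (\<lambda>w. \<phi> w + ereal ((norm (w - z))\<^sup>2 / 2)) p)"

definition moreau_env :: "real \<Rightarrow> ('a::real_normed_vector \<Rightarrow> ereal) \<Rightarrow> 'a \<Rightarrow> ereal" where
  "moreau_env \<mu> g z = (INF w. g w + ereal ((norm (w - z))\<^sup>2 / (2 * \<mu>)))"

definition cont_diff :: "('a::real_normed_vector \<Rightarrow> 'b::real_normed_vector) \<Rightarrow> bool" where
  "cont_diff F \<longleftrightarrow> (\<exists>F'. (\<forall>x. (F has_derivative blinfun_apply (F' x)) (at x)) \<and>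
     continuous_on UNIV F')"

definition grad :: "('a::real_inner \<Rightarrow> real) \<Rightarrow> 'a \<Rightarrow> 'a" where
  "grad f x = (THE v. GDERIV f x :> v)"

definition comp_obj :: "('a \<Rightarrow> real) \<Rightarrow> ('b \<Rightarrow> ereal) \<Rightarrow> ('a \<Rightarrow> 'b) \<Rightarrow> 'a \<Rightarrow> ereal" where
  "comp_obj f g c x = ereal (f x) + g (c x)"

definition standing_assumption ::
    "(real^'n \<Rightarrow> real) \<Rightarrow> (real^'m \<Rightarrow> ereal) \<Rightarrow> (real^'n \<Rightarrow> real^'m) \<Rightarrow> bool" where
  "standing_assumption f g c \<longleftrightarrow>
     cont_diff f \<and> convex_on UNIV f \<and>
     proper_fun g \<and> lsc_fun g \<and> convex_fun g \<and>
     cont_diff c \<and> neg_hzn_convex g c \<and>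
     (\<exists>x. c x \<in> edom g) \<and> (\<exists>x. minimizer (comp_obj f g c) x)"

definition min_value :: "('a \<Rightarrow> real) \<Rightarrow> ('b \<Rightarrow> ereal) \<Rightarrow> ('a \<Rightarrow> 'b) \<Rightarrow> ereal" where
  "min_value f g c = (INF x. comp_obj f g c x)"

definition stationary ::
    "(real^'n \<Rightarrow> real) \<Rightarrow> (real^'m \<Rightarrow> ereal) \<Rightarrow> (real^'n \<Rightarrow> real^'m) \<Rightarrow> real^'n \<Rightarrow> bool" where
  "stationary f g c x \<longleftrightarrow> c x \<in> edom g \<and>
     (\<exists>y\<in>subdiff g (c x). grad f x + transpose (jacobian c (at x)) *v y = 0)"

definition nonstationary ::
    "(real^'n \<Rightarrow> real) \<Rightarrow> (real^'m \<Rightarrow> ereal) \<Rightarrow> (real^'n \<Rightarrow> real^'m) \<Rightarrow> real^'n \<Rightarrow> bool" where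
  "nonstationary f g c x \<longleftrightarrow> c x \<in> edom g \<and> \<not> stationary f g c x"

definition value_fun ::
    "('a \<Rightarrow> real) \<Rightarrow> ('b::minus \<Rightarrow> ereal) \<Rightarrow> ('a \<Rightarrow> 'b) \<Rightarrow> 'b \<Rightarrow> ereal" where
  "value_fun f g c u = (INF x. ereal (f x) + g (c x - u))"

definition lagrangian ::
    "('a \<Rightarrow> real) \<Rightarrow> ('b::real_inner \<Rightarrow> ereal) \<Rightarrow> ('a \<Rightarrow> 'b) \<Rightarrow> 'a \<Rightarrow> 'b \<Rightarrow> ereal" where
  "lagrangian f g c x y = ereal (f x) + ereal (y \<bullet> c x) - conjugate_fun g y"

definition dual_fun ::
    "('a \<Rightarrow> real) \<Rightarrow> ('b::real_inner \<Rightarrow> ereal) \<Rightarrow> ('a \<Rightarrow> 'b) \<Rightarrow> 'b \<Rightarrow> ereal" where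
  "dual_fun f g c y = (INF x. lagrangian f g c x y)"

definition aug_lagrangian ::
    "('a \<Rightarrow> real) \<Rightarrow> ('b::real_normed_vector \<Rightarrow> ereal) \<Rightarrow> ('a \<Rightarrow> 'b) \<Rightarrow> real \<Rightarrow> 'a \<Rightarrow> 'b \<Rightarrow> ereal" where
  "aug_lagrangian f g c \<mu> x y =
     ereal (f x) + moreau_env \<mu> g (c x + \<mu> *\<^sub>R y) - ereal (\<mu> / 2 * (norm y)\<^sup>2)"

text \<open>
  The sequences are indexed by the iteration counter; the starting point is \<open>y 0\<close> and the
  initial penalty parameter is \<open>\<mu> 0\<close>.
\<close>
definition safeguarded_ALM ::
    "('a \<Rightarrow> real) \<Rightarrow> ('b::euclidean_space \<Rightarrow> ereal) \<Rightarrow> ('a \<Rightarrow> 'b) \<Rightarrow> 'b set \<Rightarrow> real \<Rightarrow>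
     (nat \<Rightarrow> real) \<Rightarrow> (nat \<Rightarrow> real) \<Rightarrow> (nat \<Rightarrow> 'a) \<Rightarrow> (nat \<Rightarrow> 'b) \<Rightarrow> (nat \<Rightarrow> 'b) \<Rightarrow> (nat \<Rightarrow> 'b) \<Rightarrow> bool" where
  "safeguarded_ALM f g c S \<beta> \<mu> \<epsilon> x z y yhat \<longleftrightarrow>
     \<mu> 0 > 0 \<and> S \<noteq> {} \<and> convex S \<and> compact S \<and> 0 < \<beta> \<and> \<beta> < 1 \<and>
     (\<forall>k. yhat k = closest_point S (y k) \<and>
          \<epsilon> k \<ge> 0 \<and>
          aug_lagrangian f g c (\<mu> k) (x k) (yhat k)
            \<le> (INF x'. aug_lagrangian f g c (\<mu> k) x' (yhat k)) + ereal (\<epsilon> k) \<and>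
          z k = prox (\<lambda>w. ereal (\<mu> k) * g w) (c (x k) + \<mu> k *\<^sub>R yhat k) \<and>
          y (Suc k) = yhat k + inverse (\<mu> k) *\<^sub>R (c (x k) - z k) \<and>
          (\<exists>b. b \<in> {0<..\<beta>} \<union> {1} \<and> \<mu> (Suc k) = b * \<mu> k))"

end

theory Submission
  imports Defs
begin

text \<open>
  With \<open>u = c x - z\<close>, minimizing the augmented Lagrangian over \<open>x\<close> is the same as minimizing
  \<open>V u + y \<bullet> u + (norm u)\<^sup>2 / (2 \<mu>)\<close> over \<open>u\<close>. The value function \<open>V\<close> is
  convex, so each multiplier update is an inexact proximal step on \<open>- d\<close>, taken from the
  projection onto \<open>S\<close>, with error of order \<open>sqrt (\<epsilon> / \<mu>)\<close>.

  If \<open>\<mu> = 0\<close>, a bounded subsequence of multipliers would have a cluster point whose negative is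
  a subgradient of \<open>V\<close> at 0, that is, a Lagrange multiplier, contradicting nonstationarity; an
  affine minorant of \<open>V\<close> forces \<open>c x - z\<close> to vanish. If \<open>\<mu> > 0\<close>, the penalty parameter is
  eventually constant and the method is an inexact fixed-point iteration of the composition
  of a proximal map and a projection. This composition has a fixed point by Brouwer's theorem,
  the summable errors do not destroy convergence, and fixed points minimize
  \<open>- d + \<mu> / 2 dist(., S)^2\<close>.
\<close>

section \<open>Lower semicontinuous convex functions\<close>

text \<open>The filter \<open>at z\<close> in \<open>lsc_fun\<close> omits \<open>z\<close>, while a
  sequence may hit its limit. At the limit itself the strict lower bound holds trivially, so it
  extends to \<open>nhds\<close>.\<close>

lemma lsc_funD:
  assumes "lsc_fun \<phi>" "X \<longlonglongrightarrow> x"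
  shows "\<phi> x \<le> liminf (\<lambda>k. \<phi> (X k))"
  unfolding le_Liminf_iff
proof (intro allI impI)
  fix y assume y: "y < \<phi> x"
  have "y < Liminf (at x) \<phi>"
    using assms(1) y unfolding lsc_fun_def by (meson less_le_trans)
  then have "eventually (\<lambda>u. y < \<phi> u) (at x)"
    by (rule less_LiminfD)
  then have "eventually (\<lambda>u. y < \<phi> u) (nhds x)"
    using y by (auto simp: eventually_at_filter elim: eventually_mono)
  then show "eventually (\<lambda>k. y < \<phi> (X k)) sequentially"
    using assms(2) by (rule eventually_compose_filterlim)
qed

lemma lsc_funD_le:
  fixes b :: "nat \<Rightarrow> ereal"
  assumes "lsc_fun \<phi>" "X \<longlonglongrightarrow> x" "b \<longlonglongrightarrow> a" "\<And>k. \<phi> (X k) \<le> b k"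
  shows "\<phi> x \<le> a"
proof -
  have "\<phi> x \<le> liminf (\<lambda>k. \<phi> (X k))" using assms lsc_funD by blast
  also have "\<dots> \<le> liminf b" using assms(4) by (intro Liminf_mono) auto
  also have "\<dots> = a" using assms(3) by (simp add: lim_imp_Liminf)
  finally show ?thesis .
qed

text \<open>Weierstrass argument with a minimizing sequence. Taking the limits in
  \<open>ereal\<close> allows infinite values of \<open>\<phi>\<close> and of the infimum.\<close>

lemma lsc_plus_continuous_attains_inf:
  fixes \<phi> :: "'a::metric_space \<Rightarrow> ereal" and q :: "'a \<Rightarrow> real"
  assumes lsc: "lsc_fun \<phi>" and cont: "continuous_on UNIV q" and K: "compact K" "K \<noteq> {}"
  shows "\<exists>p\<in>K. \<forall>u\<in>K. \<phi> p + ereal (q p) \<le> \<phi> u + ereal (q u)"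
proof -
  let ?h = "\<lambda>u. \<phi> u + ereal (q u)"
  obtain v where v: "\<And>n. v n \<in> ?h ` K" "v \<longlonglongrightarrow> Inf (?h ` K)"
    using Inf_as_limit[of "?h ` K"] K(2) by auto
  then have "\<forall>n. \<exists>u. u \<in> K \<and> v n = ?h u" by blast
  then obtain X where X: "\<And>n. X n \<in> K" "\<And>n. v n = ?h (X n)" by metis
  obtain l r where l: "l \<in> K" "strict_mono r" "(X \<circ> r) \<longlonglongrightarrow> l"
    using K(1) X(1) unfolding compact_def by blast
  have lim: "(\<lambda>n. v (r n)) \<longlonglongrightarrow> Inf (?h ` K)"
    using LIMSEQ_subseq_LIMSEQ[OF v(2) l(2)] by (simp add: comp_def)
  have "(\<lambda>n. q ((X \<circ> r) n)) \<longlonglongrightarrow> q l"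
    using continuous_on_tendsto_compose[OF cont l(3)] by simp
  then have q: "(\<lambda>n. ereal (q ((X \<circ> r) n))) \<longlonglongrightarrow> ereal (q l)" by simp
  have "?h l \<le> liminf (\<lambda>n. \<phi> ((X \<circ> r) n)) + ereal (q l)"
    by (intro add_right_mono lsc_funD[OF lsc l(3)])
  also have "\<dots> = liminf (\<lambda>n. v (r n))"
    using ereal_liminf_lim_add[OF q, of "\<lambda>n. \<phi> ((X \<circ> r) n)"] by (simp add: X(2) add.commute)
  also have "\<dots> = Inf (?h ` K)" using lim by (simp add: lim_imp_Liminf)
  finally show ?thesis using l(1) by (meson INF_lower order_trans)
qed

lemma proper_fun_finite:
  assumes "proper_fun \<phi>"
  obtains u r where "\<phi> u = ereal r"
proof -
  obtain u where "\<phi> u < \<infinity>" using assms by (auto simp: proper_fun_def edom_def)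
  then show ?thesis using that[of u] assms by (cases "\<phi> u") (auto simp: proper_fun_def)
qed

text \<open>Infima, as in the value function, provide near-minimizers only below strict real bounds,
  hence the form of \<open>le\<close>. A slack \<open>e\<close> sent to 0 recovers
  convexity.\<close>

lemma convex_funI:
  fixes \<phi> :: "'a::real_vector \<Rightarrow> ereal"
  assumes nm: "\<And>z. \<phi> z \<noteq> -\<infinity>"
    and le: "\<And>z w t a b. 0 < t \<Longrightarrow> t < 1 \<Longrightarrow> \<phi> z < ereal a \<Longrightarrow> \<phi> w < ereal b \<Longrightarrow>
              \<phi> (t *\<^sub>R z + (1 - t) *\<^sub>R w) \<le> ereal (t * a + (1 - t) * b)"
  shows "convex_fun \<phi>"
  unfolding convex_fun_def
proof (intro allI ballI)
  fix z w and t :: real assume "t \<in> {0..1}"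
  then consider "t = 0" | "t = 1" | "0 < t" "t < 1" by fastforce
  then show "\<phi> (t *\<^sub>R z + (1 - t) *\<^sub>R w) \<le> ereal t * \<phi> z + ereal (1 - t) * \<phi> w"
  proof cases
    case 3
    show ?thesis
    proof (cases "\<phi> z = \<infinity> \<or> \<phi> w = \<infinity>")
      case True
      then show ?thesis using 3 nm[of z] nm[of w] by (cases "\<phi> z"; cases "\<phi> w") auto
    next
      case False
      then obtain a b where ab: "\<phi> z = ereal a" "\<phi> w = ereal b"
        using nm[of z] nm[of w] by (cases "\<phi> z"; cases "\<phi> w") auto
      have "\<phi> (t *\<^sub>R z + (1 - t) *\<^sub>R w) \<le> ereal (t * a + (1 - t) * b) + ereal e" if "e > 0" for e
        using le[of t z "a + e" w "b + e"] 3 ab that by (simp add: algebra_simps)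
      then have "\<phi> (t *\<^sub>R z + (1 - t) *\<^sub>R w) \<le> ereal (t * a + (1 - t) * b)"
        by (rule ereal_le_epsilon2[rule_format])
      then show ?thesis using ab by simp
    qed
  qed (auto simp: zero_ereal_def[symmetric] one_ereal_def[symmetric])
qed

lemma convex_funD:
  fixes \<phi> :: "'a::real_vector \<Rightarrow> ereal"
  assumes "convex_fun \<phi>" "0 \<le> t" "t \<le> 1" "\<phi> z \<le> ereal a" "\<phi> w \<le> ereal b"
  shows "\<phi> (t *\<^sub>R z + (1 - t) *\<^sub>R w) \<le> ereal (t * a + (1 - t) * b)"
proof -
  have "\<phi> (t *\<^sub>R z + (1 - t) *\<^sub>R w) \<le> ereal t * \<phi> z + ereal (1 - t) * \<phi> w"
    using assms by (auto simp: convex_fun_def)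
  also have "\<dots> \<le> ereal t * ereal a + ereal (1 - t) * ereal b"
    using assms by (intro add_mono ereal_mult_left_mono) auto
  finally show ?thesis by simp
qed

text \<open>
  On the unit ball around a point of the domain, lower semicontinuity gives a lower bound;
  convexity extends it along rays at a linear rate.
\<close>
lemma convex_lsc_linear_bound:
  fixes \<phi> :: "'a::euclidean_space \<Rightarrow> ereal"
  assumes "proper_fun \<phi>" "lsc_fun \<phi>" "convex_fun \<phi>" "\<phi> u0 = ereal r0"
  obtains C where "C \<ge> 0" "\<And>u. ereal (- C - C * norm (u - u0)) \<le> \<phi> u"
proof -
  obtain q where q: "q \<in> cball u0 1" "\<And>u. u \<in> cball u0 1 \<Longrightarrow> \<phi> q \<le> \<phi> u"
    using lsc_plus_continuous_attains_inf[OF assms(2), of "\<lambda>_. 0" "cball u0 1"] by auto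
  have "\<phi> q \<le> ereal r0" using q(2)[of u0] assms(4) by simp
  then obtain m where m: "\<phi> q = ereal m" "m \<le> r0"
    using assms(1) by (cases "\<phi> q") (auto simp: proper_fun_def)
  define C where "C = \<bar>m\<bar> + \<bar>r0\<bar>"
  have "ereal (- C - C * norm (u - u0)) \<le> \<phi> u" for u
  proof (cases "norm (u - u0) \<le> 1")
    case True
    then have "ereal m \<le> \<phi> u" using q(2)[of u] m by (simp add: dist_norm norm_minus_commute)
    moreover have "0 \<le> C * norm (u - u0)" unfolding C_def by simp
    then have "- C - C * norm (u - u0) \<le> m" unfolding C_def by linarith
    ultimately show ?thesis by (meson ereal_less_eq(3) order_trans)
  next
    case False
    define s where "s = norm (u - u0)"
    have s: "s > 1" using False s_def by simp
    show ?thesis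
    proof (cases "\<phi> u")
      case (real v)
      \<comment> \<open>The point where the segment from \<open>u0\<close> to \<open>u\<close>
        leaves the unit ball; there the bound \<open>m\<close> still applies.\<close>
      let ?p = "(1 / s) *\<^sub>R u + (1 - 1 / s) *\<^sub>R u0"
      have "?p - u0 = (1 / s) *\<^sub>R (u - u0)" by (simp add: algebra_simps)
      then have "norm (?p - u0) = \<bar>1 / s\<bar> * s" unfolding s_def by (simp only: norm_scaleR)
      then have "norm (?p - u0) = 1" using s by simp
      then have "dist u0 ?p = 1" by (simp only: dist_norm norm_minus_commute)
      then have "ereal m \<le> \<phi> ?p" using q(2)[of ?p] m by simp
      also have "\<dots> \<le> ereal ((1 / s) * v + (1 - 1 / s) * r0)"
        using s real assms(4) by (intro convex_funD[OF assms(3)]) auto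
      finally have "m \<le> (1 / s) * v + (1 - 1 / s) * r0" by simp
      then have "s * m \<le> v + (s - 1) * r0" using s by (simp add: field_simps)
      moreover have "s * (- \<bar>m\<bar>) \<le> s * m" using s by (intro mult_left_mono) auto
      moreover have "(s - 1) * r0 \<le> s * \<bar>r0\<bar>"
        using s mult_left_mono[of r0 "\<bar>r0\<bar>" "s - 1"] by (simp add: algebra_simps) linarith
      ultimately have "- (C * s) \<le> v" unfolding C_def by (simp add: algebra_simps)
      moreover have "C \<ge> 0" by (simp add: C_def)
      ultimately show ?thesis using real s_def by simp
    next
      case MInf
      then show ?thesis using assms(1) by (simp add: proper_fun_def)
    qed simp
  qed
  then show ?thesis using that[of C] by (simp add: C_def)
qed

text \<open>Letting \<open>t\<close> tend to 0 from the right removes the second-order term when a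
  minimizer is compared with nearby points of a segment.\<close>

lemma nonneg_if_affine_nonneg:
  fixes A B :: real
  assumes "\<And>t. 0 < t \<Longrightarrow> t < 1 \<Longrightarrow> 0 \<le> A + t * B"
  shows "0 \<le> A"
proof -
  have "((\<lambda>t. A + t * B) \<longlongrightarrow> A + 0 * B) (at_right 0)"
    by (intro tendsto_intros)
  moreover have "eventually (\<lambda>t. 0 \<le> A + t * B) (at_right 0)"
    unfolding eventually_at_right_field using assms by (auto intro!: exI[of _ 1])
  ultimately have "0 \<le> A + 0 * B"
    by (rule tendsto_lowerbound) simp
  then show ?thesis by simp
qed

section \<open>Subgradients and proximal points\<close>

lemma subdiff_leD:
  assumes "v \<in> subdiff \<phi> p" "\<phi> p = ereal r"
  shows "ereal (r + v \<bullet> (u - p)) \<le> \<phi> u"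
  using assms by (auto simp: subdiff_def)

text \<open>Surjectivity of \<open>I + l \<partial>\<phi>\<close>: this provides both proximal points and affine minorants.\<close>
lemma ex_resolvent:
  fixes \<phi> :: "'a::euclidean_space \<Rightarrow> ereal"
  assumes prp: "proper_fun \<phi>" and lsc: "lsc_fun \<phi>" and conv: "convex_fun \<phi>" and l: "l > 0"
  shows "\<exists>p. (1 / l) *\<^sub>R (a - p) \<in> subdiff \<phi> p"
proof -
  define h where "h u = \<phi> u + ereal ((norm (u - a))\<^sup>2 / (2 * l))" for u
  obtain u0 r0 where u0: "\<phi> u0 = ereal r0" using proper_fun_finite[OF prp] .
  obtain C where C: "C \<ge> 0" "\<And>u. ereal (- C - C * norm (u - u0)) \<le> \<phi> u"
    using convex_lsc_linear_bound[OF prp lsc conv u0] by blast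
  define d where "d = norm (u0 - a)"
  define H where "H = r0 + d\<^sup>2 / (2 * l)"
  have hu0: "h u0 = ereal H" by (simp add: h_def u0 H_def d_def)
  \<comment> \<open>\<open>M\<close> and \<open>R\<close> are chosen so that the quadratic beats the
    linear lower bound: beyond distance \<open>R\<close> from \<open>u0\<close> the objective is at
    least its value at \<open>u0\<close>, and minimizing over a ball suffices.\<close>
  define M where "M = C + \<bar>H + C + C * d\<bar>"
  define R where "R = d + 1 + 2 * l * M"
  have M: "M \<ge> 0" "d \<ge> 0" using C by (auto simp: M_def d_def)
  then have R: "R \<ge> 0" using l by (simp add: R_def)
  have far: "h u0 \<le> h u" if "norm (u - u0) > R" for u
  proof -
    define s where "s = norm (u - a)"
    have tri: "norm (u - u0) \<le> s + d"
      unfolding s_def d_def using norm_triangle_ineq4[of "u - a" "u0 - a"] by simp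
    then have s1: "s \<ge> 1 + 2 * l * M" using that by (simp add: R_def)
    then have s2: "s \<ge> 1" using M l by (smt (verit) mult_nonneg_nonneg)
    have "M \<le> s / (2 * l)" using s1 l by (simp add: field_simps)
    then have "s * M \<le> s * (s / (2 * l))" using s2 by (intro mult_left_mono) auto
    moreover have "s * \<bar>H + C + C * d\<bar> \<ge> \<bar>H + C + C * d\<bar>" using mult_right_mono[OF s2, of "\<bar>H + C + C * d\<bar>"] by simp
    ultimately have "H + C + C * d + C * s \<le> s\<^sup>2 / (2 * l)"
      by (simp add: M_def algebra_simps power2_eq_square)
    moreover have "C * norm (u - u0) \<le> C * (s + d)" using tri C by (intro mult_left_mono)
    ultimately have "H \<le> - C - C * norm (u - u0) + s\<^sup>2 / (2 * l)" by (simp add: algebra_simps)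
    then have "ereal H \<le> ereal (- C - C * norm (u - u0)) + ereal (s\<^sup>2 / (2 * l))" by simp
    also have "\<dots> \<le> h u" unfolding h_def s_def using C(2) by (intro add_right_mono)
    finally show ?thesis by (simp add: hu0)
  qed
  have "continuous_on UNIV (\<lambda>u. (norm (u - a))\<^sup>2 / (2 * l))"
    using l by (intro continuous_intros) auto
  then obtain p where p: "p \<in> cball u0 R" "\<And>u. u \<in> cball u0 R \<Longrightarrow> h p \<le> h u"
    using lsc_plus_continuous_attains_inf[OF lsc, of _ "cball u0 R"] R unfolding h_def by fastforce
  have pmin: "h p \<le> h u" for u
  proof (cases "u \<in> cball u0 R")
    case False
    then have "h u0 \<le> h u" by (intro far) (simp add: dist_norm norm_minus_commute)
    moreover have "h p \<le> h u0" using p(2) R by simp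
    ultimately show ?thesis by simp
  qed (use p in auto)
  have "\<phi> p \<noteq> \<infinity>" using pmin[of u0] hu0 by (auto simp: h_def)
  then obtain r where r: "\<phi> p = ereal r" using prp by (cases "\<phi> p") (auto simp: proper_fun_def)
  have "\<phi> p + ereal (((1 / l) *\<^sub>R (a - p)) \<bullet> (u - p)) \<le> \<phi> u" for u
  proof (cases "\<phi> u")
    case (real v)
    \<comment> \<open>First-order optimality: \<open>p\<close> is compared with
      \<open>t u + (1 - t) p\<close>, and the inequality is divided by \<open>t\<close>.\<close>
    have "0 \<le> (v - r + ((p - a) \<bullet> (u - p)) / l) + t * ((norm (u - p))\<^sup>2 / (2 * l))"
      if t: "0 < t" "t < 1" for t
    proof -
      let ?w = "t *\<^sub>R u + (1 - t) *\<^sub>R p"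
      have w: "?w - a = (p - a) + t *\<^sub>R (u - p)" by (simp add: algebra_simps)
      have n: "(norm (?w - a))\<^sup>2 = (norm (p - a))\<^sup>2 + 2 * t * ((p - a) \<bullet> (u - p)) + t\<^sup>2 * (norm (u - p))\<^sup>2"
        unfolding w power2_norm_eq_inner
        by (simp add: inner_add_left[of "p - a"] inner_add_right[of _ "p - a"]
            inner_commute[of "u - p" "p - a"] power2_eq_square distrib_left)
      have expand: "(x + 2 * t * D + t\<^sup>2 * E) / (2 * l) = x / (2 * l) + t * (D / l) + t * (t * (E / (2 * l)))"
        for x D E :: real
        using l by (simp add: field_simps power2_eq_square)
      have "h p \<le> h ?w" by (rule pmin)
      also have "\<dots> \<le> ereal (t * v + (1 - t) * r) + ereal ((norm (?w - a))\<^sup>2 / (2 * l))"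
        unfolding h_def using t real r by (intro add_right_mono convex_funD[OF conv]) auto
      finally have "r + (norm (p - a))\<^sup>2 / (2 * l) \<le> t * v + (1 - t) * r + (norm (?w - a))\<^sup>2 / (2 * l)"
        by (simp add: h_def r)
      then have "0 \<le> t * ((v - r + ((p - a) \<bullet> (u - p)) / l) + t * ((norm (u - p))\<^sup>2 / (2 * l)))"
        unfolding n expand by (simp add: distrib_left right_diff_distrib left_diff_distrib)
      then show ?thesis using t by (simp add: zero_le_mult_iff)
    qed
    then have "0 \<le> v - r + ((p - a) \<bullet> (u - p)) / l" by (rule nonneg_if_affine_nonneg)
    moreover have "(a - p) \<bullet> (u - p) = - ((p - a) \<bullet> (u - p))"
      by (metis inner_minus_left minus_diff_eq)
    ultimately show ?thesis by (simp add: r real)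
  next
    case MInf
    then show ?thesis using prp by (simp add: proper_fun_def)
  qed simp
  moreover have "p \<in> edom \<phi>" using r by (simp add: edom_def)
  ultimately show ?thesis unfolding subdiff_def by blast
qed

lemma subdiff_finite:
  assumes "proper_fun \<phi>" "v \<in> subdiff \<phi> p"
  obtains r where "\<phi> p = ereal r"
  using assms by (cases "\<phi> p") (auto simp: proper_fun_def subdiff_def edom_def)

text \<open>When the square is expanded at \<open>p\<close>, the cross term cancels against the
  subgradient. The surplus quadratic in \<open>u - p\<close> expresses strong convexity and later
  yields uniqueness.\<close>

lemma resolvent_min:
  fixes \<phi> :: "'a::real_inner \<Rightarrow> ereal"
  assumes "(1 / l) *\<^sub>R (a - p) \<in> subdiff \<phi> p" "\<phi> p = ereal r" "l > 0"
  shows "ereal (r + (norm (p - a))\<^sup>2 / (2 * l) + (norm (u - p))\<^sup>2 / (2 * l))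
           \<le> \<phi> u + ereal ((norm (u - a))\<^sup>2 / (2 * l))"
proof -
  have "(norm (u - a))\<^sup>2 = (norm (p - a))\<^sup>2 - 2 * ((a - p) \<bullet> (u - p)) + (norm (u - p))\<^sup>2"
    unfolding power2_norm_eq_inner
    by (simp add: inner_commute inner_diff_left inner_diff_right)
  then have "r + (norm (p - a))\<^sup>2 / (2 * l) + (norm (u - p))\<^sup>2 / (2 * l)
      = (r + ((1 / l) *\<^sub>R (a - p)) \<bullet> (u - p)) + (norm (u - a))\<^sup>2 / (2 * l)"
    by (simp add: diff_divide_distrib add_divide_distrib)
  moreover have "ereal ((r + ((1 / l) *\<^sub>R (a - p)) \<bullet> (u - p)) + (norm (u - a))\<^sup>2 / (2 * l))
     \<le> \<phi> u + ereal ((norm (u - a))\<^sup>2 / (2 * l))"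
    using add_right_mono[OF subdiff_leD[OF assms(1,2), of u], of "ereal ((norm (u - a))\<^sup>2 / (2 * l))"]
    by (simp only: plus_ereal.simps(1))
  ultimately show ?thesis by (simp only:)
qed

text \<open>The surplus term of \<open>resolvent_min\<close> forces every minimizer to equal
  \<open>p\<close>, which resolves the \<open>THE\<close> in \<open>prox\<close>.\<close>

lemma prox_eqI:
  fixes \<phi> :: "'a::real_inner \<Rightarrow> ereal"
  assumes sub: "(1 / l) *\<^sub>R (a - p) \<in> subdiff \<phi> p" and r: "\<phi> p = ereal r" and l: "l > 0"
  shows "prox (\<lambda>w. ereal l * \<phi> w) a = p"
  unfolding prox_def
proof (rule the_equality)
  let ?h = "\<lambda>w. ereal l * \<phi> w + ereal ((norm (w - a))\<^sup>2 / 2)"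
  \<comment> \<open>Factoring out \<open>l\<close> turns the unit-step objective of the scaled
    function into the step-\<open>l\<close> objective of \<open>\<phi>\<close>.\<close>
  have eq: "?h w = ereal l * (\<phi> w + ereal ((norm (w - a))\<^sup>2 / (2 * l)))" for w
    using l by (cases "\<phi> w") (auto simp: field_simps)
  have strong: "?h p + ereal ((norm (u - p))\<^sup>2 / 2) \<le> ?h u" for u
  proof -
    have "?h p + ereal ((norm (u - p))\<^sup>2 / 2)
       = ereal l * ereal (r + (norm (p - a))\<^sup>2 / (2 * l) + (norm (u - p))\<^sup>2 / (2 * l))"
      using l by (simp add: r field_simps)
    also have "\<dots> \<le> ?h u"
      unfolding eq using l by (intro ereal_mult_left_mono resolvent_min[OF sub r]) auto
    finally show ?thesis .
  qed
  have fin: "?h p = ereal (l * r + (norm (p - a))\<^sup>2 / 2)" by (simp add: r)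
  have "?h p \<le> ?h u" for u
  proof -
    have "?h p \<le> ?h p + ereal ((norm (u - p))\<^sup>2 / 2)" unfolding fin by simp
    then show ?thesis using strong[of u] by (rule order_trans)
  qed
  then show "minimizer ?h p" using fin by (auto simp: minimizer_def edom_def)
  fix q assume "minimizer ?h q"
  then have "?h q \<le> ?h p" by (simp add: minimizer_def)
  with strong[of q] have "?h p + ereal ((norm (q - p))\<^sup>2 / 2) \<le> ?h p" by (rule order_trans)
  then show "q = p" unfolding fin by simp
qed

lemma moreau_env_eq:
  fixes \<phi> :: "'a::real_inner \<Rightarrow> ereal"
  assumes sub: "(1 / l) *\<^sub>R (a - p) \<in> subdiff \<phi> p" and r: "\<phi> p = ereal r" and l: "l > 0"
  shows "moreau_env l \<phi> a = ereal (r + (norm (p - a))\<^sup>2 / (2 * l))"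
  unfolding moreau_env_def
proof (rule antisym)
  show "(INF w. \<phi> w + ereal ((norm (w - a))\<^sup>2 / (2 * l))) \<le> ereal (r + (norm (p - a))\<^sup>2 / (2 * l))"
    using r by (intro INF_lower2[of p]) auto
  show "ereal (r + (norm (p - a))\<^sup>2 / (2 * l)) \<le> (INF w. \<phi> w + ereal ((norm (w - a))\<^sup>2 / (2 * l)))"
  proof (rule INF_greatest)
    fix u
    have "ereal (r + (norm (p - a))\<^sup>2 / (2 * l))
       \<le> ereal (r + (norm (p - a))\<^sup>2 / (2 * l) + (norm (u - p))\<^sup>2 / (2 * l))" using l by simp
    also have "\<dots> \<le> \<phi> u + ereal ((norm (u - a))\<^sup>2 / (2 * l))" by (rule resolvent_min[OF sub r l])
    finally show "ereal (r + (norm (p - a))\<^sup>2 / (2 * l)) \<le> \<phi> u + ereal ((norm (u - a))\<^sup>2 / (2 * l))" .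
  qed
qed

lemma subdiff_monotone:
  assumes "proper_fun \<phi>" "v \<in> subdiff \<phi> p" "w \<in> subdiff \<phi> q"
  shows "(v - w) \<bullet> (p - q) \<ge> 0"
proof -
  obtain r where "\<phi> p = ereal r" using subdiff_finite[OF assms(1,2)] .
  moreover obtain s where "\<phi> q = ereal s" using subdiff_finite[OF assms(1,3)] .
  ultimately have "r + v \<bullet> (q - p) \<le> s" "s + w \<bullet> (p - q) \<le> r"
    using subdiff_leD[OF assms(2), of r q] subdiff_leD[OF assms(3), of s p] by auto
  then show ?thesis by (simp add: inner_diff_left inner_diff_right)
qed

text \<open>Read as upper bounds on \<open>\<phi> (p k)\<close>, the subgradient inequalities pass
  to the limit by lower semicontinuity. A test point in the domain then shows that
  \<open>\<phi> q\<close> is finite.\<close>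

lemma closed_subdiff_graph:
  fixes \<phi> :: "'a::real_inner \<Rightarrow> ereal"
  assumes lsc: "lsc_fun \<phi>" and prp: "proper_fun \<phi>"
    and sub: "\<And>k. v k \<in> subdiff \<phi> (p k)" and v: "v \<longlonglongrightarrow> w" and p: "p \<longlonglongrightarrow> q"
  shows "w \<in> subdiff \<phi> q"
proof -
  have le: "\<phi> q \<le> ereal (s - w \<bullet> (u - q))" if s: "\<phi> u = ereal s" for u s
  proof (rule lsc_funD_le[OF lsc p])
    show "(\<lambda>k. ereal (s - v k \<bullet> (u - p k))) \<longlonglongrightarrow> ereal (s - w \<bullet> (u - q))"
      by (intro tendsto_intros v p)
    fix k
    obtain r where "\<phi> (p k) = ereal r" using subdiff_finite[OF prp sub] .
    then show "\<phi> (p k) \<le> ereal (s - v k \<bullet> (u - p k))"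
      using subdiff_leD[OF sub, of k r u] s by simp
  qed
  obtain u0 s0 where "\<phi> u0 = ereal s0" using proper_fun_finite[OF prp] .
  then have "\<phi> q < \<infinity>" using le by fastforce
  then obtain r where r: "\<phi> q = ereal r" using prp by (cases "\<phi> q") (auto simp: proper_fun_def)
  have "\<phi> q + ereal (w \<bullet> (u - q)) \<le> \<phi> u" for u
    using le[of u] r prp by (cases "\<phi> u") (auto simp: proper_fun_def)
  then show ?thesis using r by (auto simp: subdiff_def edom_def)
qed

section \<open>Inexact iteration of compositions of firmly nonexpansive maps\<close>

text \<open>Subtracting the partial sums of \<open>e\<close> leaves a nonincreasing sequence bounded
  below by \<open>- suminf e\<close>.\<close>

lemma convergent_of_summable_increments:
  fixes a e :: "nat \<Rightarrow> real"
  assumes a: "\<And>k. 0 \<le> a k" and le: "\<And>k. a (Suc k) \<le> a k + e k" and e: "summable e" "\<And>k. 0 \<le> e k"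
  shows "convergent a"
proof -
  define b where "b k = a k - (\<Sum>i<k. e i)" for k
  have "decseq b" by (rule decseq_SucI) (use le in \<open>simp add: b_def algebra_simps\<close>)
  moreover have "- suminf e \<le> b k" for k
    using a[of k] sum_le_suminf[OF e(1), of "{..<k}"] e(2) by (simp add: b_def)
  ultimately have "convergent b" using decseq_convergent convergentI by metis
  moreover have "convergent (\<lambda>k. \<Sum>i<k. e i)" using e(1) by (simp add: summable_iff_convergent)
  ultimately have "convergent (\<lambda>k. b k + (\<Sum>i<k. e i))" by (rule convergent_add)
  then show ?thesis by (simp add: b_def)
qed

lemma tendsto_zero_of_norm_square:
  assumes "(\<lambda>k. (norm (X k))\<^sup>2) \<longlonglongrightarrow> 0"
  shows "X \<longlonglongrightarrow> 0"
proof -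
  have "(\<lambda>k. sqrt ((norm (X k))\<^sup>2)) \<longlonglongrightarrow> sqrt 0" using assms by (rule tendsto_real_sqrt)
  then show ?thesis by (simp add: tendsto_norm_zero_iff)
qed

definition firmly_nonexpansive :: "('a::real_inner \<Rightarrow> 'a) \<Rightarrow> bool" where
  "firmly_nonexpansive T \<longleftrightarrow> (\<forall>v w. (norm (T v - T w))\<^sup>2 \<le> (v - w) \<bullet> (T v - T w))"

text \<open>Expand the square of the difference of residuals. The residual term is the gain over
  plain nonexpansiveness: it must vanish once distances stop decreasing.\<close>

lemma firmly_nonexpansive_residual:
  assumes "firmly_nonexpansive T"
  shows "(norm (T v - T w))\<^sup>2 + (norm ((v - T v) - (w - T w)))\<^sup>2 \<le> (norm (v - w))\<^sup>2"
proof -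
  have "(norm ((v - w) - (T v - T w)))\<^sup>2
     = (norm (v - w))\<^sup>2 - 2 * ((v - w) \<bullet> (T v - T w)) + (norm (T v - T w))\<^sup>2"
    unfolding power2_norm_eq_inner
    by (simp add: inner_diff_left[of "v - w"] inner_diff_right[of _ "v - w"]
        inner_commute[of "T v - T w" "v - w"])
  moreover have "(v - w) - (T v - T w) = (v - T v) - (w - T w)" by simp
  ultimately show ?thesis
    using assms[unfolded firmly_nonexpansive_def, rule_format, of v w] by simp
qed

lemma firmly_nonexpansive_nonexpansive:
  assumes "firmly_nonexpansive T"
  shows "norm (T v - T w) \<le> norm (v - w)"
proof -
  have "(norm (T v - T w))\<^sup>2 \<le> (norm (v - w))\<^sup>2"
    using firmly_nonexpansive_residual[OF assms, of v w] by (smt (verit) zero_le_power2)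
  then show ?thesis by (rule power2_le_imp_le) simp
qed

lemma firmly_nonexpansive_continuous:
  assumes "firmly_nonexpansive T"
  shows "continuous_on X T"
  unfolding continuous_on_iff dist_norm
  using firmly_nonexpansive_nonexpansive[OF assms] by (meson le_less_trans)

text \<open>Sum of the variational inequalities of the two projections.\<close>

lemma firmly_nonexpansive_closest_point:
  assumes "convex S" "closed S" "S \<noteq> {}"
  shows "firmly_nonexpansive (closest_point S)"
  unfolding firmly_nonexpansive_def
proof (intro allI)
  fix v w
  let ?p = "closest_point S v" and ?q = "closest_point S w"
  have "(v - ?p) \<bullet> (?q - ?p) \<le> 0" "(w - ?q) \<bullet> (?p - ?q) \<le> 0"
    using assms by (auto intro!: closest_point_dot closest_point_in_set)
  then show "(norm (?p - ?q))\<^sup>2 \<le> (v - w) \<bullet> (?p - ?q)"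
    unfolding power2_norm_eq_inner
    by (simp add: inner_diff_left inner_diff_right inner_commute)
qed

text \<open>
  The iterates are quasi-Fejer monotone with respect to the fixed points of \<open>T \<circ> P\<close>, and the
  residuals of both maps are controlled by the decrease of the distance to a fixed point.
\<close>
lemma inexact_iteration_converges:
  fixes P T :: "'a::euclidean_space \<Rightarrow> 'a"
  assumes P: "firmly_nonexpansive P" and T: "firmly_nonexpansive T"
    and fp: "T (P p) = p"
    and step: "\<And>k. norm (y (Suc k) - T (P (y k))) \<le> e k"
    and e: "summable e"
  shows "\<exists>q. y \<longlonglongrightarrow> q \<and> T (P q) = q"
proof -
  have e0: "0 \<le> e k" for k using step[of k] norm_ge_zero order_trans by blast
  have elim: "e \<longlonglongrightarrow> 0" using e by (rule summable_LIMSEQ_zero)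
  have conv: "convergent (\<lambda>k. norm (y k - q))" if q: "T (P q) = q" for q
  proof (rule convergent_of_summable_increments[OF _ _ e e0])
    fix k
    have "norm (T (P (y k)) - q) \<le> norm (y k - q)"
      using firmly_nonexpansive_nonexpansive[OF T, of "P (y k)" "P q"]
        firmly_nonexpansive_nonexpansive[OF P, of "y k" q] q by simp
    moreover have "norm (y (Suc k) - q) \<le> norm (y (Suc k) - T (P (y k))) + norm (T (P (y k)) - q)"
      using norm_triangle_ineq[of "y (Suc k) - T (P (y k))" "T (P (y k)) - q"] by simp
    ultimately show "norm (y (Suc k) - q) \<le> norm (y k - q) + e k" using step[of k] by linarith
  qed simp
  obtain a where a: "(\<lambda>k. norm (y k - p)) \<longlonglongrightarrow> a" using conv[OF fp] by (auto simp: convergent_def)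
  \<comment> \<open>The distance after the exact step lies between the next distance minus
    \<open>e k\<close> and the current one, so it has the same limit.\<close>
  have "(\<lambda>k. norm (T (P (y k)) - p)) \<longlonglongrightarrow> a"
  proof (rule tendsto_sandwich)
    show "(\<lambda>k. norm (y (Suc k) - p) - e k) \<longlonglongrightarrow> a"
      using tendsto_diff[OF LIMSEQ_Suc[OF a] elim] by simp
    have "norm (y (Suc k) - p) - e k \<le> norm (T (P (y k)) - p)" for k
      using step[of k] norm_triangle_ineq[of "y (Suc k) - T (P (y k))" "T (P (y k)) - p"] by simp
    then show "\<forall>\<^sub>F k in sequentially. norm (y (Suc k) - p) - e k \<le> norm (T (P (y k)) - p)" by simp
    have "norm (T (P (y k)) - p) \<le> norm (y k - p)" for k
      using firmly_nonexpansive_nonexpansive[OF T, of "P (y k)" "P p"]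
        firmly_nonexpansive_nonexpansive[OF P, of "y k" p] fp by simp
    then show "\<forall>\<^sub>F k in sequentially. norm (T (P (y k)) - p) \<le> norm (y k - p)" by simp
  qed (rule a)
  then have gap: "(\<lambda>k. (norm (y k - p))\<^sup>2 - (norm (T (P (y k)) - p))\<^sup>2) \<longlonglongrightarrow> 0"
    using tendsto_diff[OF tendsto_power[OF a] tendsto_power, of _ a 2 2] by fastforce
  \<comment> \<open>Residuals of \<open>P\<close> and \<open>T\<close> relative to those at
    \<open>p\<close>. The offsets \<open>p - P p\<close> and \<open>P p - p\<close> cancel in
    \<open>A k + B k\<close>, which is \<open>y k - T (P (y k))\<close>.\<close>
  define A where "A k = (y k - P (y k)) - (p - P p)" for k
  define B where "B k = (P (y k) - T (P (y k))) - (P p - p)" for k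
  have AB: "(norm (A k))\<^sup>2 + (norm (B k))\<^sup>2 \<le> (norm (y k - p))\<^sup>2 - (norm (T (P (y k)) - p))\<^sup>2" for k
    using firmly_nonexpansive_residual[OF P, of "y k" p]
      firmly_nonexpansive_residual[OF T, of "P (y k)" "P p"] fp by (simp add: A_def B_def)
  have "A \<longlonglongrightarrow> 0"
    by (rule tendsto_zero_of_norm_square, rule tendsto_sandwich[OF _ _ tendsto_const gap])
      (auto intro!: always_eventually intro: order_trans[OF _ AB])
  moreover have "B \<longlonglongrightarrow> 0"
    by (rule tendsto_zero_of_norm_square, rule tendsto_sandwich[OF _ _ tendsto_const gap])
      (auto intro!: always_eventually intro: order_trans[OF _ AB])
  ultimately have "(\<lambda>k. A k + B k) \<longlonglongrightarrow> 0" using tendsto_add by fastforce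
  then have res: "(\<lambda>k. y k - T (P (y k))) \<longlonglongrightarrow> 0" by (simp add: A_def B_def)
  have "Bseq (\<lambda>k. norm (y k - p))" using conv[OF fp] by (rule convergent_imp_Bseq)
  then obtain M where "\<And>k. norm (y k - p) \<le> M" by (auto simp: Bseq_def)
  then have "y k \<in> cball p M" for k by (simp add: dist_norm norm_minus_commute)
  then obtain q r where q: "strict_mono r" "(y \<circ> r) \<longlonglongrightarrow> q"
    using compact_cball[of p M] unfolding compact_def by metis
  have "continuous_on UNIV (\<lambda>v. T (P v))"
    using firmly_nonexpansive_continuous[OF T] firmly_nonexpansive_continuous[OF P]
    by (rule continuous_on_compose2) auto
  from continuous_on_tendsto_compose[OF this q(2)]
  have "(\<lambda>j. T (P (y (r j)))) \<longlonglongrightarrow> T (P q)" by (simp add: comp_def)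
  then have "(\<lambda>j. (y \<circ> r) j - T (P (y (r j)))) \<longlonglongrightarrow> q - T (P q)" using q(2) by (intro tendsto_diff)
  moreover have "(\<lambda>j. (y \<circ> r) j - T (P (y (r j)))) \<longlonglongrightarrow> 0"
    using LIMSEQ_subseq_LIMSEQ[OF res q(1)] by (simp add: comp_def)
  ultimately have fq: "T (P q) = q" using LIMSEQ_unique by fastforce
  \<comment> \<open>The cluster point \<open>q\<close> is itself a fixed point, so the distances to
    it converge as a whole; their limit is read off along the subsequence.\<close>
  obtain b where b: "(\<lambda>k. norm (y k - q)) \<longlonglongrightarrow> b" using conv[OF fq] by (auto simp: convergent_def)
  have "(\<lambda>j. norm ((y \<circ> r) j - q)) \<longlonglongrightarrow> norm (q - q)"
    using q(2) by (intro tendsto_intros)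
  moreover have "(\<lambda>j. norm ((y \<circ> r) j - q)) \<longlonglongrightarrow> b"
    using LIMSEQ_subseq_LIMSEQ[OF b q(1)] by (simp add: comp_def)
  ultimately have "b = 0" using LIMSEQ_unique by fastforce
  then have "(\<lambda>k. y k - q) \<longlonglongrightarrow> 0" using b tendsto_norm_zero_iff by blast
  then have "y \<longlonglongrightarrow> q" using LIM_zero_iff by blast
  with fq show ?thesis by blast
qed

section \<open>The value function\<close>

lemma value_fun_le: "value_fun f g c u \<le> ereal (f x) + g (c x - u)"
  unfolding value_fun_def by (rule INF_lower) simp

lemma value_fun_0: "value_fun f g c 0 = min_value f g (c :: _ \<Rightarrow> 'b::group_add)"
  by (simp add: value_fun_def min_value_def comp_obj_def)

text \<open>At a convex combination, \<open>c\<close> differs from the combination of its values by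
  a horizon direction of \<open>g\<close>, along which \<open>g\<close> does not increase.
  Near-minimizers \<open>x\<close>, \<open>x'\<close> replace the infima.\<close>

lemma convex_value_fun:
  fixes c :: "'a::real_vector \<Rightarrow> 'b::real_vector"
  assumes f: "convex_on UNIV f" and g: "proper_fun g" "convex_fun g" and c: "neg_hzn_convex g c"
    and V: "proper_fun (value_fun f g c)"
  shows "convex_fun (value_fun f g c)"
proof (rule convex_funI)
  show "value_fun f g c z \<noteq> -\<infinity>" for z using V by (simp add: proper_fun_def)
  fix z w and t a b :: real
  assume t: "0 < t" "t < 1" and z: "value_fun f g c z < ereal a" and w: "value_fun f g c w < ereal b"
  obtain x where x: "ereal (f x) + g (c x - z) < ereal a" using z by (auto simp: value_fun_def INF_less_iff)
  obtain x' where x': "ereal (f x') + g (c x' - w) < ereal b" using w by (auto simp: value_fun_def INF_less_iff)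
  have gx: "g (c x - z) \<le> ereal (a - f x)" using x by (cases "g (c x - z)") auto
  have gx': "g (c x' - w) \<le> ereal (b - f x')" using x' by (cases "g (c x' - w)") auto
  let ?X = "t *\<^sub>R x + (1 - t) *\<^sub>R x'" and ?u = "t *\<^sub>R z + (1 - t) *\<^sub>R w"
  let ?m = "t *\<^sub>R (c x - z) + (1 - t) *\<^sub>R (c x' - w)" and ?v = "c (t *\<^sub>R x + (1 - t) *\<^sub>R x') - t *\<^sub>R c x - (1 - t) *\<^sub>R c x'"
  have gm: "g ?m \<le> ereal (t * (a - f x) + (1 - t) * (b - f x'))"
    using t gx gx' by (intro convex_funD[OF g(2)]) auto
  \<comment> \<open>Needed because \<open>hzn\<close> tests only points of the domain.\<close>
  then have "?m \<in> edom g" using le_less_trans[OF gm, of \<infinity>] by (simp add: edom_def)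
  moreover have "?v \<in> hzn g" using c t unfolding neg_hzn_convex_def by simp
  ultimately have "g (?m + ?v) \<le> g ?m" by (simp add: hzn_def)
  from this gm have "g (?m + ?v) \<le> ereal (t * (a - f x) + (1 - t) * (b - f x'))" by (rule order_trans)
  moreover have "?m + ?v = c ?X - ?u" by (simp add: algebra_simps)
  ultimately have gX: "g (c ?X - ?u) \<le> ereal (t * (a - f x) + (1 - t) * (b - f x'))"
    by (simp only:)
  have "f ?X \<le> t * f x + (1 - t) * f x'"
    using convex_onD[OF f, of "1 - t" x x'] t by simp
  then have "ereal (f ?X) + g (c ?X - ?u) \<le> ereal (t * f x + (1 - t) * f x') + ereal (t * (a - f x) + (1 - t) * (b - f x'))"
    using gX by (intro add_mono) auto
  also have "\<dots> = ereal (t * a + (1 - t) * b)" by (simp add: algebra_simps)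
  finally show "value_fun f g c ?u \<le> ereal (t * a + (1 - t) * b)"
    by (rule order_trans[OF value_fun_le])
qed

text \<open>Weak duality, by the Fenchel-Young inequality for \<open>g\<close> at
  \<open>c x - u\<close>. Behind it, the dual function at \<open>v\<close> is minus the conjugate of
  the value function at \<open>- v\<close>.\<close>

lemma dual_fun_le:
  fixes c :: "'a \<Rightarrow> 'b::real_inner"
  assumes g: "proper_fun g" and r: "value_fun f g c u = ereal r"
  shows "dual_fun f g c v \<le> ereal (r + v \<bullet> u)"
proof -
  have le: "dual_fun f g c v \<le> ereal (f x) + g (c x - u) + ereal (v \<bullet> u)" for x
  proof -
    have "dual_fun f g c v \<le> lagrangian f g c x v" unfolding dual_fun_def by (rule INF_lower) simp
    moreover have "ereal (v \<bullet> (c x - u)) - g (c x - u) \<le> conjugate_fun g v"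
      unfolding conjugate_fun_def by (rule SUP_upper) simp
    then have "lagrangian f g c x v \<le> ereal (f x) + g (c x - u) + ereal (v \<bullet> u)"
      using g unfolding lagrangian_def
      by (cases "g (c x - u)"; cases "conjugate_fun g v") (auto simp: inner_diff_right proper_fun_def)
    ultimately show ?thesis by (rule order_trans)
  qed
  have "dual_fun f g c v - ereal (v \<bullet> u) \<le> value_fun f g c u"
    unfolding value_fun_def by (rule INF_greatest) (use le in \<open>simp add: ereal_minus_le\<close>)
  then show ?thesis using r by (simp add: ereal_minus_le)
qed

text \<open>The subgradient bounds \<open>f x + g w\<close> from below for all \<open>x\<close> and
  \<open>w\<close>; the supremum over \<open>w\<close> produces the conjugate, so weak duality is
  tight.\<close>

lemma dual_fun_eq:
  fixes c :: "'a \<Rightarrow> 'b::real_inner"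
  assumes g: "proper_fun g" and r: "value_fun f g c u = ereal r" and sub: "- v \<in> subdiff (value_fun f g c) u"
  shows "dual_fun f g c v = ereal (r + v \<bullet> u)"
proof (rule antisym)
  show "dual_fun f g c v \<le> ereal (r + v \<bullet> u)" by (rule dual_fun_le[OF g r])
  show "ereal (r + v \<bullet> u) \<le> dual_fun f g c v"
    unfolding dual_fun_def
  proof (rule INF_greatest)
    fix x
    have "conjugate_fun g v \<le> ereal (f x + v \<bullet> c x - (r + v \<bullet> u))"
      unfolding conjugate_fun_def
    proof (rule SUP_least)
      fix w
      have "ereal (r + (- v) \<bullet> ((c x - w) - u)) \<le> ereal (f x) + g w"
        using subdiff_leD[OF sub r, of "c x - w"] value_fun_le[of f g c "c x - w" x] by (simp add: order_trans)
      then show "ereal (v \<bullet> w) - g w \<le> ereal (f x + v \<bullet> c x - (r + v \<bullet> u))"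
        by (cases "g w") (auto simp: inner_diff_right)
    qed
    then show "ereal (r + v \<bullet> u) \<le> lagrangian f g c x v"
      unfolding lagrangian_def by (cases "conjugate_fun g v") auto
  qed
qed

section \<open>Multipliers and stationarity\<close>

lemma cont_diff_continuous:
  assumes "cont_diff F"
  shows "continuous_on UNIV F"
proof -
  obtain F' where "\<And>x. (F has_derivative blinfun_apply (F' x)) (at x)"
    using assms by (auto simp: cont_diff_def)
  then show ?thesis by (meson continuous_at_imp_continuous_on has_derivative_continuous)
qed

text \<open>The adjoint of the derivative applied to 1 is its Riesz representative; uniqueness of
  derivatives resolves the \<open>THE\<close> in \<open>grad\<close>.\<close>

lemma grad_has_derivative:
  fixes f :: "'a::euclidean_space \<Rightarrow> real"
  assumes "f differentiable (at x)"
  shows "(f has_derivative (\<lambda>h. h \<bullet> grad f x)) (at x)"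
proof -
  obtain D where D: "(f has_derivative D) (at x)" using assms by (auto simp: differentiable_def)
  have lin: "linear D" using D by (rule has_derivative_linear)
  have Deq: "D = (\<lambda>h. h \<bullet> adjoint D 1)"
    using adjoint_works[OF lin, of _ 1] by (simp add: fun_eq_iff)
  have G: "GDERIV f x :> adjoint D 1" using D unfolding gderiv_def Deq[symmetric] .
  have eq: "grad f x = adjoint D 1"
    unfolding grad_def
  proof (rule the_equality, rule G)
    fix v assume "GDERIV f x :> v"
    then have "(\<lambda>h. h \<bullet> v) = (\<lambda>h. h \<bullet> adjoint D 1)"
      using G unfolding gderiv_def by (rule has_derivative_unique)
    then show "v = adjoint D 1" by (simp add: fun_eq_iff vector_eq_ldot)
  qed
  show ?thesis using G unfolding gderiv_def eq .
qed

text \<open>The subgradient gives a joint lower bound in \<open>x\<close> and \<open>w\<close>.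
  Fixing \<open>x = x0\<close> makes \<open>v\<close> a subgradient of \<open>g\<close>; fixing
  \<open>w = c x0\<close> makes \<open>x0\<close> a minimizer of \<open>f\<close> plus the pairing
  of \<open>v\<close> with \<open>c\<close>. The minus sign stems from the shift
  \<open>c x - u\<close>.\<close>

lemma multiplier_imp_stationary:
  fixes f :: "real^'n \<Rightarrow> real" and c :: "real^'n \<Rightarrow> real^'m"
  assumes f: "cont_diff f" and c: "cont_diff c" and g: "proper_fun g"
    and x0: "minimizer (comp_obj f g c) x0" and v: "- v \<in> subdiff (value_fun f g c) 0"
  shows "stationary f g c x0"
proof -
  have "g (c x0) \<noteq> \<infinity>" using x0 by (auto simp: minimizer_def edom_def comp_obj_def)
  then obtain g0 where g0: "g (c x0) = ereal g0" using g by (cases "g (c x0)") (auto simp: proper_fun_def)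
  have "value_fun f g c 0 = comp_obj f g c x0"
    unfolding value_fun_0 min_value_def
    using x0 by (intro antisym INF_lower INF_greatest) (auto simp: minimizer_def)
  then have V0: "value_fun f g c 0 = ereal (f x0 + g0)" by (simp add: comp_obj_def g0)
  have saddle: "ereal (f x0 + g0 - v \<bullet> (c x - w)) \<le> ereal (f x) + g w" for x w
    using order_trans[OF subdiff_leD[OF v V0, of "c x - w"] value_fun_le[of f g c "c x - w" x]] by simp
  have "ereal (g0 + v \<bullet> (w - c x0)) \<le> g w" for w
    using saddle[of x0 w] by (cases "g w") (auto simp: inner_diff_right)
  then have "v \<in> subdiff g (c x0)" by (simp add: subdiff_def edom_def g0)
  moreover have "grad f x0 + transpose (jacobian c (at x0)) *v v = 0"
  proof -
    let ?J = "jacobian c (at x0)"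
    have "f differentiable (at x0)" using f by (auto simp: cont_diff_def differentiable_def)
    then have df: "(f has_derivative (\<lambda>h. h \<bullet> grad f x0)) (at x0)" by (rule grad_has_derivative)
    have "c differentiable (at x0)" using c by (auto simp: cont_diff_def differentiable_def)
    then have dc: "(c has_derivative (\<lambda>h. ?J *v h)) (at x0)" by (simp add: jacobian_works)
    have "((\<lambda>x. f x + v \<bullet> c x) has_derivative (\<lambda>h. h \<bullet> grad f x0 + v \<bullet> (?J *v h))) (at x0)"
      by (intro derivative_intros df dc)
    moreover have "f x0 + v \<bullet> c x0 \<le> f x + v \<bullet> c x" for x
      using saddle[of x "c x0"] by (simp add: g0 inner_diff_right)
    ultimately have "(\<lambda>h. h \<bullet> grad f x0 + v \<bullet> (?J *v h)) = (\<lambda>h. 0)"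
      by (intro has_derivative_local_min) auto
    then have "h \<bullet> (grad f x0 + v v* ?J) = 0" for h
      by (simp add: fun_eq_iff inner_add_right dot_lmul_matrix inner_commute[of h "v v* ?J"])
    from this[of "grad f x0 + v v* ?J"] show ?thesis by (simp add: transpose_matrix_vector)
  qed
  ultimately show ?thesis by (auto simp: stationary_def edom_def g0)
qed

section \<open>One step of the method\<close>

text \<open>Completing the square. The last term is exactly what the augmented Lagrangian
  subtracts.\<close>

lemma norm_shift_eq:
  fixes u v :: "'a::real_inner"
  assumes "m > 0"
  shows "(norm ((w - u) - (w + m *\<^sub>R v)))\<^sup>2 / (2 * m) = v \<bullet> u + (norm u)\<^sup>2 / (2 * m) + m / 2 * (norm v)\<^sup>2"
proof -
  have "(w - u) - (w + m *\<^sub>R v) = - (u + m *\<^sub>R v)" by (simp add: algebra_simps)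
  then have "(norm ((w - u) - (w + m *\<^sub>R v)))\<^sup>2 = (norm (u + m *\<^sub>R v))\<^sup>2" by (simp only: norm_minus_cancel)
  also have "\<dots> = (norm u)\<^sup>2 + 2 * m * (v \<bullet> u) + m\<^sup>2 * (norm v)\<^sup>2"
    unfolding power2_norm_eq_inner
    by (simp add: inner_add_left inner_add_right inner_commute power2_eq_square)
  finally show ?thesis using assms by (simp add: field_simps power2_eq_square)
qed

text \<open>
  Substituting \<open>w = c x - u\<close> in the Moreau envelope turns minimization of the augmented
  Lagrangian into a proximal step on the value function, inexact up to \<open>\<epsilon>\<close>.
\<close>
lemma ALM_step_value_fun:
  fixes f :: "'a \<Rightarrow> real" and g :: "'b::euclidean_space \<Rightarrow> ereal"
  assumes g: "proper_fun g" "lsc_fun g" "convex_fun g" and m: "m > 0"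
    and x: "aug_lagrangian f g c m x v \<le> (INF x'. aug_lagrangian f g c m x' v) + ereal e"
    and z: "z = prox (\<lambda>w. ereal m * g w) (c x + m *\<^sub>R v)"
  obtains gz where "g z = ereal gz"
    "\<And>w. ereal (f x + gz + v \<bullet> (c x - z) + (norm (c x - z))\<^sup>2 / (2 * m))
       \<le> value_fun f g c w + ereal (v \<bullet> w + (norm w)\<^sup>2 / (2 * m) + e)"
proof -
  let ?A = "aug_lagrangian f g c m"
  obtain p where p: "(1 / m) *\<^sub>R ((c x + m *\<^sub>R v) - p) \<in> subdiff g p"
    using ex_resolvent[OF g m] by blast
  obtain gz where gz: "g p = ereal gz" using subdiff_finite[OF g(1) p] .
  have zp: "z = p" unfolding z by (rule prox_eqI[OF p gz m])
  have "c x - (c x - p) = p" by simp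
  then have Ax: "?A x v = ereal (f x + gz + v \<bullet> (c x - p) + (norm (c x - p))\<^sup>2 / (2 * m))"
    unfolding aug_lagrangian_def moreau_env_eq[OF p gz m]
    using norm_shift_eq[OF m, of "c x" "c x - p" v] by simp
  have "?A x v \<le> value_fun f g c w + ereal (v \<bullet> w + (norm w)\<^sup>2 / (2 * m) + e)" for w
  proof -
    let ?q = "v \<bullet> w + (norm w)\<^sup>2 / (2 * m)"
    \<comment> \<open>The envelope is tested at \<open>c x' - w\<close>; the infimum over
      \<open>x'\<close> then brings in the value function.\<close>
    have A: "?A x' v \<le> ereal (f x') + g (c x' - w) + ereal ?q" for x'
    proof -
      have "moreau_env m g (c x' + m *\<^sub>R v)
          \<le> g (c x' - w) + ereal (?q + m / 2 * (norm v)\<^sup>2)"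
        unfolding moreau_env_def norm_shift_eq[OF m, of "c x'" w v, symmetric] by (rule INF_lower) simp
      then show ?thesis
        using g(1) unfolding aug_lagrangian_def
        by (cases "g (c x' - w)"; cases "moreau_env m g (c x' + m *\<^sub>R v)") (auto simp: proper_fun_def)
    qed
    have "(INF x'. ?A x' v) - ereal ?q \<le> value_fun f g c w"
      unfolding value_fun_def
    proof (rule INF_greatest)
      fix x'
      have "(INF x'. ?A x' v) \<le> ?A x' v" by (rule INF_lower) simp
      also note A
      finally show "(INF x'. ?A x' v) - ereal ?q \<le> ereal (f x') + g (c x' - w)"
        by (simp add: ereal_minus_le)
    qed
    then have "(INF x'. ?A x' v) \<le> value_fun f g c w + ereal ?q" by (simp add: ereal_minus_le)
    then have "(INF x'. ?A x' v) + ereal e \<le> value_fun f g c w + ereal ?q + ereal e"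
      by (rule add_right_mono)
    then show ?thesis using x by (simp add: add.assoc)
  qed
  then show ?thesis using that[of gz] Ax zp gz by simp
qed

text \<open>\<open>T\<close> is the proximal map of the negative dual function with step \<open>1 / m\<close>.\<close>
lemma ex_dual_prox:
  fixes V :: "'a::euclidean_space \<Rightarrow> ereal"
  assumes "proper_fun V" "lsc_fun V" "convex_fun V" "m > 0"
  obtains T where "\<And>v. - T v \<in> subdiff V (m *\<^sub>R (T v - v))"
proof -
  have "\<exists>t. - t \<in> subdiff V (m *\<^sub>R (t - v))" for v
  proof -
    \<comment> \<open>The new dual point is \<open>v + p / m\<close>; the signs flip because
      multipliers are negatives of subgradients of \<open>V\<close>.\<close>
    obtain p where p: "(1 / m) *\<^sub>R (- (m *\<^sub>R v) - p) \<in> subdiff V p"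
      using ex_resolvent[OF assms] by blast
    have "m *\<^sub>R ((v + (1 / m) *\<^sub>R p) - v) = p" using assms(4) by simp
    moreover have "(1 / m) *\<^sub>R (- (m *\<^sub>R v) - p) = - (v + (1 / m) *\<^sub>R p)"
      using assms(4) by (simp add: scaleR_diff_right)
    ultimately show ?thesis using p by metis
  qed
  then show ?thesis using that by metis
qed

text \<open>Monotonicity of the subdifferential of \<open>V\<close>, expanded, is the claim
  multiplied by \<open>m\<close>.\<close>

lemma firmly_nonexpansive_dual_prox:
  fixes V :: "'a::euclidean_space \<Rightarrow> ereal"
  assumes "proper_fun V" "m > 0" "\<And>v. - T v \<in> subdiff V (m *\<^sub>R (T v - v))"
  shows "firmly_nonexpansive T"
  unfolding firmly_nonexpansive_def
proof (intro allI)
  fix v w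
  have "(- T v - - T w) \<bullet> (m *\<^sub>R (T v - v) - m *\<^sub>R (T w - w)) \<ge> 0"
    using subdiff_monotone[OF assms(1) assms(3) assms(3)] .
  also have "(- T v - - T w) \<bullet> (m *\<^sub>R (T v - v) - m *\<^sub>R (T w - w))
      = m * ((v - w) \<bullet> (T v - T w) - (norm (T v - T w))\<^sup>2)"
    unfolding power2_norm_eq_inner
    by (simp add: inner_diff_left inner_diff_right inner_commute algebra_simps)
  finally show "(norm (T v - T w))\<^sup>2 \<le> (v - w) \<bullet> (T v - T w)"
    using assms(2) by (simp add: zero_le_mult_iff)
qed

text \<open>The exact minimizer \<open>w\<close> of the regularized \<open>V\<close> corresponds to
  \<open>t\<close>. Quadratic growth around \<open>w\<close> turns \<open>e\<close>-optimality of
  \<open>u\<close> into a squared distance of at most \<open>2 * m * e\<close>, and the multipliers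
  differ by \<open>(u - w) / m\<close>. \<open>F\<close> only bounds \<open>V u\<close>, since the
  infimum in the value function need not be attained.\<close>

lemma multiplier_update_error:
  fixes V :: "'a::real_inner \<Rightarrow> ereal"
  assumes V: "proper_fun V" and m: "m > 0" and t: "- t \<in> subdiff V (m *\<^sub>R (t - v))"
    and F: "V u \<le> ereal F"
    and le: "\<And>w. ereal (F + v \<bullet> u + (norm u)\<^sup>2 / (2 * m)) \<le> V w + ereal (v \<bullet> w + (norm w)\<^sup>2 / (2 * m) + e)"
  shows "norm (v + inverse m *\<^sub>R u - t) \<le> sqrt 2 * sqrt (e / m)"
proof -
  define w where "w = m *\<^sub>R (t - v)"
  have tv: "t = v + inverse m *\<^sub>R w" using m by (simp add: w_def)
  obtain r where r: "V w = ereal r" using subdiff_finite[OF V t] w_def by metis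
  have "r - t \<bullet> (u - w) \<le> F"
    using order_trans[OF subdiff_leD[OF t[folded w_def] r, of u] F] by simp
  moreover have "F + v \<bullet> u + (norm u)\<^sup>2 / (2 * m) \<le> r + (v \<bullet> w + (norm w)\<^sup>2 / (2 * m) + e)"
    using le[of w] r by simp
  moreover have "t \<bullet> (u - w) = v \<bullet> (u - w) + (w \<bullet> (u - w)) / m"
    unfolding tv by (simp add: inner_add_left divide_inverse mult.commute)
  ultimately have e: "(norm u)\<^sup>2 / (2 * m) - (norm w)\<^sup>2 / (2 * m) - (w \<bullet> (u - w)) / m \<le> e"
    by (simp add: inner_diff_right)
  have "(norm (u - w))\<^sup>2 = (norm u)\<^sup>2 - (norm w)\<^sup>2 - 2 * (w \<bullet> (u - w))"
    unfolding power2_norm_eq_inner by (simp add: inner_diff_left inner_diff_right inner_commute)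
  then have "(norm (u - w))\<^sup>2 / (2 * m)
      = (norm u)\<^sup>2 / (2 * m) - (norm w)\<^sup>2 / (2 * m) - (w \<bullet> (u - w)) / m"
    by (simp add: diff_divide_distrib)
  with e have "(norm (u - w))\<^sup>2 / (2 * m) \<le> e" by simp
  then have n: "(norm (u - w))\<^sup>2 / m\<^sup>2 \<le> 2 * (e / m)" using m by (simp add: field_simps power2_eq_square)
  have "v + inverse m *\<^sub>R u - t = inverse m *\<^sub>R (u - w)" unfolding tv by (simp add: scaleR_diff_right)
  then have "(norm (v + inverse m *\<^sub>R u - t))\<^sup>2 = (norm (u - w))\<^sup>2 / m\<^sup>2"
    using m by (simp add: power_mult_distrib divide_inverse power_inverse)
  with n have "(norm (v + inverse m *\<^sub>R u - t))\<^sup>2 \<le> 2 * (e / m)" by simp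
  then show ?thesis using real_le_rsqrt real_sqrt_mult by metis
qed

text \<open>The shift \<open>m (t - closest_point S t)\<close> is the gradient at \<open>t\<close>
  of the distance penalty, and by duality its negative is a subgradient of the negative dual
  function there. The two slopes cancel.\<close>

lemma fixed_point_minimizes_dual:
  fixes c :: "'a \<Rightarrow> 'b::euclidean_space"
  assumes g: "proper_fun g" and V: "proper_fun (value_fun f g c)" and m: "m > 0"
    and S: "convex S" "closed S" "S \<noteq> {}"
    and t: "- t \<in> subdiff (value_fun f g c) (m *\<^sub>R (t - closest_point S t))"
  shows "minimizer (\<lambda>v. - dual_fun f g c v + ereal (m / 2 * (infdist v S)\<^sup>2)) t"
proof -
  define u where "u = m *\<^sub>R (t - closest_point S t)"
  obtain r where r: "value_fun f g c u = ereal r" using subdiff_finite[OF V t] u_def by metis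
  have dt: "dual_fun f g c t = ereal (r + t \<bullet> u)" by (rule dual_fun_eq[OF g r]) (use t u_def in simp)
  have dist: "infdist v S = norm (v - closest_point S v)" for v
    using S by (simp add: infdist_eq_setdist setdist_closest_point dist_norm)
  have "ereal (- (r + t \<bullet> u) + m / 2 * (infdist t S)\<^sup>2)
      \<le> - dual_fun f g c v + ereal (m / 2 * (infdist v S)\<^sup>2)" for v
  proof -
    let ?p = "closest_point S t" and ?q = "closest_point S v"
    \<comment> \<open>Towards the gradient inequality of the squared distance at \<open>t\<close>;
      the projection inequality disposes of the term in \<open>?q - ?p\<close>.\<close>
    have "(t - ?p) \<bullet> (?q - ?p) \<le> 0"
      using S by (intro closest_point_dot closest_point_in_set)
    moreover have "(norm (v - ?q))\<^sup>2 = (norm (t - ?p))\<^sup>2 + 2 * ((t - ?p) \<bullet> ((v - ?q) - (t - ?p)))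
        + (norm ((v - ?q) - (t - ?p)))\<^sup>2"
      unfolding power2_norm_eq_inner
      by (simp add: inner_diff_left[of "v - ?q"] inner_diff_right[of _ "v - ?q"] inner_commute[of "v - ?q" "t - ?p"])
    moreover have "(t - ?p) \<bullet> ((v - ?q) - (t - ?p)) = (t - ?p) \<bullet> (v - t) - (t - ?p) \<bullet> (?q - ?p)"
      by (simp add: inner_diff_right)
    ultimately have "(norm (t - ?p))\<^sup>2 + 2 * ((t - ?p) \<bullet> (v - t)) \<le> (norm (v - ?q))\<^sup>2"
      by (smt (verit) zero_le_power2)
    then have "m / 2 * ((norm (t - ?p))\<^sup>2 + 2 * ((t - ?p) \<bullet> (v - t))) \<le> m / 2 * (norm (v - ?q))\<^sup>2"
      using m by (intro mult_left_mono) auto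
    moreover have "(v - t) \<bullet> u = m * ((t - ?p) \<bullet> (v - t))"
      unfolding u_def by (simp only: inner_scaleR_right inner_commute)
    ultimately have le: "m / 2 * (infdist t S)\<^sup>2 + (v - t) \<bullet> u \<le> m / 2 * (infdist v S)\<^sup>2"
      unfolding dist by (simp add: distrib_left)
    have "- ereal (r + v \<bullet> u) \<le> - dual_fun f g c v"
      using dual_fun_le[OF g r] by (simp only: ereal_minus_le_minus)
    then have "- ereal (r + v \<bullet> u) + ereal (m / 2 * (infdist v S)\<^sup>2)
        \<le> - dual_fun f g c v + ereal (m / 2 * (infdist v S)\<^sup>2)" by (rule add_right_mono)
    then show ?thesis
      by (rule order_trans[rotated]) (use le in \<open>simp add: inner_diff_left\<close>)
  qed
  then show ?thesis by (simp add: minimizer_def edom_def dt)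
qed

theorem theorem5p8:
  fixes f :: "real^'n \<Rightarrow> real"
    and g :: "real^'m \<Rightarrow> ereal"
    and c :: "real^'n \<Rightarrow> real^'m"
    and S :: "(real^'m) set"
    and \<beta> \<mu> :: real
    and mu \<epsilon> :: "nat \<Rightarrow> real"
    and x :: "nat \<Rightarrow> real^'n"
    and z y yhat :: "nat \<Rightarrow> real^'m"
  assumes standing: "standing_assumption f g c"
    and nonstat: "\<forall>xbar. minimizer (comp_obj f g c) xbar \<longrightarrow> nonstationary f g c xbar"
    and value_proper: "proper_fun (value_fun f g c)"
    and value_lsc: "lsc_fun (value_fun f g c)"
    and alm: "safeguarded_ALM f g c S \<beta> mu \<epsilon> x z y yhat"
    and eps_summable: "summable (\<lambda>k. sqrt (\<epsilon> k / mu k))"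
    and mu_lim: "mu \<longlonglongrightarrow> \<mu>"
  shows
    "(\<mu> = 0 \<longrightarrow>
        filterlim (\<lambda>k. norm (y k)) at_top sequentially \<and>
        limsup (\<lambda>k. ereal (f (x k)) + g (z k)) \<le> min_value f g c \<and>
        (\<forall>xbar r. strict_mono r \<and> (x \<circ> r) \<longlonglongrightarrow> xbar \<longrightarrow>
           minimizer (comp_obj f g c) xbar) \<and>
        (\<forall>xbar r. strict_mono r \<and> (x \<circ> r) \<longlonglongrightarrow> xbar \<longrightarrow>
           (z \<circ> r) \<longlonglongrightarrow> c xbar \<and>
           (\<lambda>j. ereal (f (x (r j))) + g (z (r j))) \<longlonglongrightarrow> min_value f g c)) \<and>
     (\<mu> > 0 \<longrightarrow>
        (\<exists>ybar. y \<longlonglongrightarrow> ybar \<and>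
           minimizer (\<lambda>v. - dual_fun f g c v + ereal (\<mu> / 2 * (infdist v S)\<^sup>2)) ybar))"
proof -
  let ?V = "value_fun f g c"
  have f: "cont_diff f" "convex_on UNIV f" and g: "proper_fun g" "lsc_fun g" "convex_fun g"
    and c: "cont_diff c" "neg_hzn_convex g c"
    using standing by (simp_all add: standing_assumption_def)
  obtain x0 where x0: "minimizer (comp_obj f g c) x0"
    using standing by (auto simp: standing_assumption_def)
  have Vconv: "convex_fun ?V" by (rule convex_value_fun[OF f(2) g(1,3) c(2) value_proper])
  have min0: "min_value f g c = comp_obj f g c x0"
    unfolding min_value_def using x0
    by (intro antisym INF_lower INF_greatest) (auto simp: minimizer_def)
  have "g (c x0) \<noteq> \<infinity>" using x0 by (auto simp: minimizer_def edom_def comp_obj_def)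
  then obtain \<Phi> where \<Phi>: "min_value f g c = ereal \<Phi>"
    using g(1) by (cases "g (c x0)") (auto simp: min0 comp_obj_def proper_fun_def)
  have V0: "?V 0 = ereal \<Phi>" by (simp add: value_fun_0 \<Phi>)
  have S: "S \<noteq> {}" "convex S" "compact S" "closed S" and \<beta>: "\<beta> < 1" and mu0: "mu 0 > 0"
    using alm by (auto simp: safeguarded_ALM_def compact_imp_closed)
  have yhat: "yhat k = closest_point S (y k)" and eps: "\<epsilon> k \<ge> 0"
    and xk: "aug_lagrangian f g c (mu k) (x k) (yhat k)
      \<le> (INF x'. aug_lagrangian f g c (mu k) x' (yhat k)) + ereal (\<epsilon> k)"
    and zk: "z k = prox (\<lambda>w. ereal (mu k) * g w) (c (x k) + mu k *\<^sub>R yhat k)"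
    and yk: "y (Suc k) = yhat k + inverse (mu k) *\<^sub>R (c (x k) - z k)"
    and muk: "\<exists>b. b \<in> {0<..\<beta>} \<union> {1} \<and> mu (Suc k) = b * mu k" for k
    using alm unfolding safeguarded_ALM_def by blast+
  have mu: "mu k > 0" for k
  proof (induction k)
    case (Suc k)
    then show ?case using muk[of k] by auto
  qed (rule mu0)

  \<comment> \<open>The iteration as an inexact proximal step\<close>
  define u where "u k = c (x k) - z k" for k
  have "\<exists>gz. g (z k) = ereal gz \<and> (\<forall>w. ereal (f (x k) + gz + yhat k \<bullet> u k + (norm (u k))\<^sup>2 / (2 * mu k))
       \<le> ?V w + ereal (yhat k \<bullet> w + (norm w)\<^sup>2 / (2 * mu k) + \<epsilon> k))" for k
    unfolding u_def by (rule ALM_step_value_fun[OF g mu xk zk]) blast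
  then obtain gz where gz: "\<And>k. g (z k) = ereal (gz k)"
    and approx: "\<And>k w. ereal (f (x k) + gz k + yhat k \<bullet> u k + (norm (u k))\<^sup>2 / (2 * mu k))
       \<le> ?V w + ereal (yhat k \<bullet> w + (norm w)\<^sup>2 / (2 * mu k) + \<epsilon> k)" by metis
  define F where "F k = f (x k) + gz k" for k
  have Vu: "?V (u k) \<le> ereal (F k)" for k
    using value_fun_le[of f g c "u k" "x k"] by (simp add: u_def F_def gz)
  define err where "err k = sqrt 2 * sqrt (\<epsilon> k / mu k)" for k
  have err_summable: "summable err"
    using eps_summable unfolding err_def by (rule summable_mult)
  have update: "norm (y (Suc k) - t) \<le> err k"
    if "- t \<in> subdiff ?V (mu k *\<^sub>R (t - yhat k))" for k t
    using multiplier_update_error[OF value_proper mu that Vu, where e = "\<epsilon> k"] approx[of k]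
    by (simp add: yk u_def[symmetric] F_def err_def)
  have "\<exists>T. \<forall>v. - T v \<in> subdiff ?V (mu k *\<^sub>R (T v - v))" for k
    using ex_dual_prox[OF value_proper value_lsc Vconv mu[of k]] by metis
  \<comment> \<open>\<open>T k (yhat k)\<close> is the multiplier that exact minimization would
    give; by \<open>update\<close> the actual one is within \<open>err k\<close> of it.\<close>
  then obtain T where T: "\<And>k v. - T k v \<in> subdiff ?V (mu k *\<^sub>R (T k v - v))" by metis

  \<comment> \<open>Vanishing penalty parameter\<close>
  have part1: "filterlim (\<lambda>k. norm (y k)) at_top sequentially \<and>
        limsup (\<lambda>k. ereal (f (x k)) + g (z k)) \<le> min_value f g c \<and>
        (\<forall>xbar r. strict_mono r \<and> (x \<circ> r) \<longlonglongrightarrow> xbar \<longrightarrow>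
           minimizer (comp_obj f g c) xbar) \<and>
        (\<forall>xbar r. strict_mono r \<and> (x \<circ> r) \<longlonglongrightarrow> xbar \<longrightarrow>
           (z \<circ> r) \<longlonglongrightarrow> c xbar \<and>
           (\<lambda>j. ereal (f (x (r j))) + g (z (r j))) \<longlonglongrightarrow> min_value f g c)"
    if "\<mu> = 0"
  proof -
    have mu_0: "mu \<longlonglongrightarrow> 0" using mu_lim that by simp
    obtain B where B: "\<And>v. v \<in> S \<Longrightarrow> norm v \<le> B"
      using compact_imp_bounded[OF S(3)] by (auto simp: bounded_iff)
    have yB: "norm (yhat k) \<le> B" for k
      unfolding yhat using S by (intro B closest_point_in_set)
    have "(\<lambda>k. sqrt (\<epsilon> k / mu k)) \<longlonglongrightarrow> 0" using eps_summable by (rule summable_LIMSEQ_zero)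
    then have "(\<lambda>k. mu k * (sqrt (\<epsilon> k / mu k))\<^sup>2) \<longlonglongrightarrow> 0 * 0\<^sup>2"
      by (intro tendsto_intros mu_0)
    moreover have "mu k * (sqrt (\<epsilon> k / mu k))\<^sup>2 = \<epsilon> k" for k using eps[of k] mu[of k] by simp
    ultimately have eps_0: "\<epsilon> \<longlonglongrightarrow> 0" by simp
    have approx0: "F k + yhat k \<bullet> u k + (norm (u k))\<^sup>2 / (2 * mu k) \<le> \<Phi> + \<epsilon> k" for k
      using approx[of k 0] by (simp add: V0 F_def)
    \<comment> \<open>The last term bounds the loss from completing the square, since
      \<open>yhat k\<close> has norm at most \<open>B\<close>.\<close>
    define b where "b k = \<Phi> + \<epsilon> k + mu k / 2 * B\<^sup>2" for k
    have Fb: "F k \<le> b k" for k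
    proof -
      have "(norm ((w - u k) - (w + mu k *\<^sub>R yhat k)))\<^sup>2 / (2 * mu k) \<ge> 0" for w :: "real^'m"
        using mu[of k] by simp
      then have "0 \<le> yhat k \<bullet> u k + (norm (u k))\<^sup>2 / (2 * mu k) + mu k / 2 * (norm (yhat k))\<^sup>2"
        by (simp only: norm_shift_eq[OF mu])
      moreover have "mu k / 2 * (norm (yhat k))\<^sup>2 \<le> mu k / 2 * B\<^sup>2"
        using mu[of k] yB[of k] by (intro mult_left_mono power_mono) auto
      ultimately show ?thesis using approx0[of k] by (simp add: b_def)
    qed
    have "b \<longlonglongrightarrow> \<Phi> + 0 + 0 / 2 * B\<^sup>2" unfolding b_def by (intro tendsto_intros eps_0 mu_0) simp
    then have b_lim: "b \<longlonglongrightarrow> \<Phi>" by simp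
    have obj: "ereal (f (x k)) + g (z k) = ereal (F k)" for k by (simp add: gz F_def)
    have limsup: "limsup (\<lambda>j. ereal (F (r j))) \<le> ereal \<Phi>" if r: "strict_mono r" for r
    proof -
      have "(\<lambda>j. ereal (b (r j))) \<longlonglongrightarrow> ereal \<Phi>"
        using LIMSEQ_subseq_LIMSEQ[OF b_lim r] by (simp add: comp_def)
      then have "limsup (\<lambda>j. ereal (b (r j))) = ereal \<Phi>" by (simp add: lim_imp_Limsup)
      moreover have "limsup (\<lambda>j. ereal (F (r j))) \<le> limsup (\<lambda>j. ereal (b (r j)))"
        using Fb by (intro Limsup_mono) auto
      ultimately show ?thesis by simp
    qed
    have u_0: "u \<longlonglongrightarrow> 0"
    proof -
      \<comment> \<open>Any subgradient of the value function supplies an affine minorant;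
        \<open>T 0\<close> at 0 is a convenient source of one.\<close>
      obtain p r where p: "- T 0 0 \<in> subdiff ?V p" and r: "?V p = ereal r"
        using T[of 0 0] subdiff_finite[OF value_proper] by metis
      define a where "a = r + T 0 0 \<bullet> p"
      define L where "L = norm (T 0 0) + B"
      have sq: "(norm (u k))\<^sup>2 \<le> 4 * mu k * (\<Phi> + \<epsilon> k - a) + 4 * (mu k)\<^sup>2 * L\<^sup>2" for k
      proof -
        have "r + (- T 0 0) \<bullet> (u k - p) \<le> F k"
          using order_trans[OF subdiff_leD[OF p r] Vu, of k] by simp
        then have "a - T 0 0 \<bullet> u k \<le> F k" by (simp add: a_def inner_diff_right)
        moreover have "T 0 0 \<bullet> u k \<le> norm (T 0 0) * norm (u k)" by (rule norm_cauchy_schwarz)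
        moreover have "- (yhat k \<bullet> u k) \<le> B * norm (u k)"
          using Cauchy_Schwarz_ineq2[of "yhat k" "u k"] mult_right_mono[OF yB[of k], of "norm (u k)"] by simp
        ultimately have "(norm (u k))\<^sup>2 / (2 * mu k) \<le> \<Phi> + \<epsilon> k - a + L * norm (u k)"
          using approx0[of k] by (simp add: L_def distrib_right)
        then have "(norm (u k))\<^sup>2 \<le> 2 * mu k * (\<Phi> + \<epsilon> k - a) + 2 * mu k * L * norm (u k)"
          using mu[of k] by (simp add: field_simps)
        \<comment> \<open>Young's inequality absorbs the linear term into half of the left-hand
          side.\<close>
        moreover have "0 \<le> (norm (u k) - 2 * mu k * L)\<^sup>2" by simp
        then have "4 * mu k * L * norm (u k) \<le> (norm (u k))\<^sup>2 + 4 * (mu k)\<^sup>2 * L\<^sup>2"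
          by (simp add: power2_diff power_mult_distrib algebra_simps)
        ultimately show ?thesis by simp
      qed
      have "(\<lambda>k. 4 * mu k * (\<Phi> + \<epsilon> k - a) + 4 * (mu k)\<^sup>2 * L\<^sup>2) \<longlonglongrightarrow> 4 * 0 * (\<Phi> + 0 - a) + 4 * 0\<^sup>2 * L\<^sup>2"
        by (intro tendsto_intros mu_0 eps_0)
      then have "(\<lambda>k. 4 * mu k * (\<Phi> + \<epsilon> k - a) + 4 * (mu k)\<^sup>2 * L\<^sup>2) \<longlonglongrightarrow> 0" by simp
      then have "(\<lambda>k. (norm (u k))\<^sup>2) \<longlonglongrightarrow> 0"
        by (rule tendsto_sandwich[OF _ _ tendsto_const, rotated 2]) (use sq in auto)
      then show ?thesis by (rule tendsto_zero_of_norm_square)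
    qed
    have acc: "minimizer (comp_obj f g c) xbar \<and> (z \<circ> r) \<longlonglongrightarrow> c xbar \<and>
           (\<lambda>j. ereal (f (x (r j))) + g (z (r j))) \<longlonglongrightarrow> min_value f g c"
      if r: "strict_mono r" and xr: "(x \<circ> r) \<longlonglongrightarrow> xbar" for xbar r
    proof -
      have cx: "(\<lambda>j. c (x (r j))) \<longlonglongrightarrow> c xbar" and fx: "(\<lambda>j. f (x (r j))) \<longlonglongrightarrow> f xbar"
        using continuous_on_tendsto_compose[OF cont_diff_continuous[OF c(1)] xr]
          continuous_on_tendsto_compose[OF cont_diff_continuous[OF f(1)] xr] by (simp_all add: comp_def)
      have "(\<lambda>j. u (r j)) \<longlonglongrightarrow> 0" using LIMSEQ_subseq_LIMSEQ[OF u_0 r] by (simp add: comp_def)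
      from tendsto_diff[OF cx this] have zr: "(\<lambda>j. z (r j)) \<longlonglongrightarrow> c xbar" by (simp add: u_def)
      have br: "(\<lambda>j. b (r j)) \<longlonglongrightarrow> \<Phi>" using LIMSEQ_subseq_LIMSEQ[OF b_lim r] by (simp add: comp_def)
      have "g (c xbar) \<le> ereal (\<Phi> - f xbar)"
      proof (rule lsc_funD_le[OF g(2) zr])
        show "(\<lambda>j. ereal (b (r j) - f (x (r j)))) \<longlonglongrightarrow> ereal (\<Phi> - f xbar)"
          by (intro tendsto_intros br fx)
        show "g (z (r j)) \<le> ereal (b (r j) - f (x (r j)))" for j
          using Fb[of "r j"] by (simp add: gz F_def)
      qed
      then have "comp_obj f g c xbar \<le> ereal \<Phi>"
        by (cases "g (c xbar)") (auto simp: comp_obj_def)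
      then have "comp_obj f g c xbar \<le> min_value f g c" by (simp add: \<Phi>)
      moreover have lower: "min_value f g c \<le> comp_obj f g c w" for w
        unfolding min_value_def by (rule INF_lower) simp
      ultimately have xmin: "minimizer (comp_obj f g c) xbar"
        unfolding minimizer_def edom_def using \<Phi>
        by (auto intro: order_trans le_less_trans)
      \<comment> \<open>Lower semicontinuity bounds the lower limit from below by the optimal value,
        closing the squeeze with \<open>limsup\<close>.\<close>
      have "ereal \<Phi> \<le> ereal (f xbar) + g (c xbar)" using lower[of xbar] by (simp add: \<Phi> comp_obj_def)
      also have "\<dots> \<le> ereal (f xbar) + liminf (\<lambda>j. g (z (r j)))"
        by (intro add_left_mono lsc_funD[OF g(2) zr])
      also have "\<dots> = liminf (\<lambda>j. ereal (f (x (r j))) + g (z (r j)))"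
        using fx by (intro ereal_liminf_lim_add[symmetric]) auto
      finally have "ereal \<Phi> \<le> liminf (\<lambda>j. ereal (F (r j)))" by (simp add: obj)
      moreover have "limsup (\<lambda>j. ereal (F (r j))) \<le> ereal \<Phi>" by (rule limsup[OF r])
      moreover have "liminf (\<lambda>j. ereal (F (r j))) \<le> limsup (\<lambda>j. ereal (F (r j)))"
        by (rule Liminf_le_Limsup) simp
      ultimately have "(\<lambda>j. ereal (F (r j))) \<longlonglongrightarrow> ereal \<Phi>"
        by (subst tendsto_iff_Liminf_eq_Limsup) auto
      then show ?thesis using xmin zr by (simp add: obj \<Phi> comp_def)
    qed
    \<comment> \<open>Only \<open>y (Suc k)\<close> comes from an update; \<open>y 0\<close> is free
      data.\<close>
    have "filterlim (\<lambda>k. norm (y (Suc k))) at_top sequentially"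
      unfolding filterlim_at_top
    proof (rule ccontr)
      assume "\<not> (\<forall>Z. \<forall>\<^sub>F k in sequentially. Z \<le> norm (y (Suc k)))"
      then obtain Z where "\<exists>\<^sub>F k in sequentially. \<not> Z \<le> norm (y (Suc k))"
        by (auto simp: not_eventually)
      then have "infinite {k. \<not> Z \<le> norm (y (Suc k))}"
        by (simp add: frequently_cofinite cofinite_eq_sequentially[symmetric])
      then obtain r :: "nat \<Rightarrow> nat" where r: "strict_mono r" "\<And>j. \<not> Z \<le> norm (y (Suc (r j)))"
        using infinite_enumerate by blast
      have "y (Suc (r j)) \<in> cball 0 Z" for j using r(2)[of j] by simp
      then obtain s v where s: "strict_mono s" "((\<lambda>j. y (Suc (r j))) \<circ> s) \<longlonglongrightarrow> v"
        using compact_cball[of "0 :: real^'m" Z] unfolding compact_def by metis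
      define \<rho> where "\<rho> = r \<circ> s"
      have \<rho>: "strict_mono \<rho>" unfolding \<rho>_def using r(1) s(1) by (rule strict_mono_o)
      have yv: "(\<lambda>j. y (Suc (\<rho> j))) \<longlonglongrightarrow> v" using s(2) by (simp add: \<rho>_def comp_def)
      \<comment> \<open>Exact multipliers satisfy the subgradient relation exactly and share the
        limit \<open>v\<close>, because the errors vanish.\<close>
      define t where "t j = T (\<rho> j) (yhat (\<rho> j))" for j
      have "(\<lambda>j. err (\<rho> j)) \<longlonglongrightarrow> 0"
        using LIMSEQ_subseq_LIMSEQ[OF summable_LIMSEQ_zero[OF err_summable] \<rho>] by (simp add: comp_def)
      then have "(\<lambda>j. y (Suc (\<rho> j)) - t j) \<longlonglongrightarrow> 0"
        by (rule Lim_null_comparison[rotated]) (use update[OF T] in \<open>simp add: t_def\<close>)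
      from tendsto_diff[OF yv this] have tv: "t \<longlonglongrightarrow> v" by simp
      \<comment> \<open>The points at which \<open>- t j\<close> is a subgradient; they tend to 0
        since \<open>t\<close> and \<open>yhat\<close> stay bounded while \<open>mu\<close>
        vanishes.\<close>
      define p where "p j = mu (\<rho> j) *\<^sub>R (t j - yhat (\<rho> j))" for j
      have mur: "(\<lambda>j. mu (\<rho> j)) \<longlonglongrightarrow> 0" using LIMSEQ_subseq_LIMSEQ[OF mu_0 \<rho>] by (simp add: comp_def)
      have "(\<lambda>j. mu (\<rho> j) * (norm (t j) + B)) \<longlonglongrightarrow> 0 * (norm v + B)"
        by (intro tendsto_intros mur tv)
      then have "(\<lambda>j. mu (\<rho> j) * (norm (t j) + B)) \<longlonglongrightarrow> 0" by simp
      moreover have "norm (p j) \<le> mu (\<rho> j) * (norm (t j) + B)" for j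
        using mu[of "\<rho> j"] norm_triangle_ineq4[of "t j" "yhat (\<rho> j)"] yB[of "\<rho> j"]
        by (simp add: p_def mult_left_mono)
      then have "\<forall>\<^sub>F j in sequentially. norm (p j) \<le> mu (\<rho> j) * (norm (t j) + B)" by simp
      ultimately have p_0: "p \<longlonglongrightarrow> 0" by (rule Lim_null_comparison[rotated])
      have "- t j \<in> subdiff ?V (p j)" for j unfolding t_def p_def by (rule T)
      from closed_subdiff_graph[OF value_lsc value_proper this tendsto_minus[OF tv] p_0]
      have "- v \<in> subdiff ?V 0" .
      then have "stationary f g c x0" by (rule multiplier_imp_stationary[OF f(1) c(1) g(1) x0])
      then show False using nonstat x0 by (auto simp: nonstationary_def)
    qed
    then have "filterlim (\<lambda>k. norm (y k)) at_top sequentially"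
      using filterlim_sequentially_Suc[where f = "\<lambda>k. norm (y k)"] by blast
    moreover have "limsup (\<lambda>k. ereal (f (x k)) + g (z k)) \<le> min_value f g c"
      using limsup[of id] by (simp add: obj \<Phi> strict_mono_def)
    ultimately show ?thesis using acc by blast
  qed

  \<comment> \<open>Penalty parameter with positive limit\<close>
  have part2: "\<exists>ybar. y \<longlonglongrightarrow> ybar \<and>
           minimizer (\<lambda>v. - dual_fun f g c v + ereal (\<mu> / 2 * (infdist v S)\<^sup>2)) ybar"
    if pos: "\<mu> > 0"
  proof -
    \<comment> \<open>The ratios tend to 1, which exceeds \<open>\<beta>\<close>; eventually every
      reduction factor must therefore be 1.\<close>
    have "(\<lambda>k. mu (Suc k) / mu k) \<longlonglongrightarrow> \<mu> / \<mu>"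
      using pos by (intro tendsto_divide LIMSEQ_Suc mu_lim) auto
    then have "\<forall>\<^sub>F k in sequentially. \<beta> < mu (Suc k) / mu k"
      using \<beta> pos by (intro order_tendstoD(1)) auto
    then obtain N where N: "\<And>k. k \<ge> N \<Longrightarrow> \<beta> < mu (Suc k) / mu k"
      by (auto simp: eventually_sequentially)
    have Suc_eq: "mu (Suc k) = mu k" if "k \<ge> N" for k
    proof -
      obtain b where "b \<in> {0<..\<beta>} \<union> {1}" "mu (Suc k) = b * mu k" using muk by blast
      then show ?thesis using N[OF that] mu[of k] by auto
    qed
    have const: "mu (k + N) = mu N" for k
      by (induction k) (use Suc_eq in auto)
    have "(\<lambda>k. mu (k + N)) \<longlonglongrightarrow> \<mu>" using mu_lim by (rule LIMSEQ_ignore_initial_segment)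
    then have muN: "mu (k + N) = \<mu>" for k using LIMSEQ_const_iff[of "mu N" \<mu>] by (simp add: const)
    have T': "- T N v \<in> subdiff ?V (\<mu> *\<^sub>R (T N v - v))" for v
      using T[of N v] muN[of 0] by simp
    have fT: "firmly_nonexpansive (T N)"
      using value_proper pos T' by (rule firmly_nonexpansive_dual_prox)
    have fP: "firmly_nonexpansive (closest_point S)"
      using S by (intro firmly_nonexpansive_closest_point)
    \<comment> \<open>Brouwer needs a compact convex set mapped into itself, so it is applied on
      \<open>S\<close> with the projection last; \<open>T N\<close> carries that fixed point to one
      of the composition in the other order.\<close>
    have "continuous_on S (\<lambda>v. closest_point S (T N v))"
      using firmly_nonexpansive_continuous[OF fP] firmly_nonexpansive_continuous[OF fT]
      by (rule continuous_on_compose2) auto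
    moreover have "(\<lambda>v. closest_point S (T N v)) \<in> S \<rightarrow> S"
      using S by (auto intro: closest_point_in_set)
    ultimately obtain q where q: "closest_point S (T N q) = q"
      using brouwer[OF S(3) S(2) S(1)] by metis
    have "\<exists>v. (\<lambda>k. y (k + N)) \<longlonglongrightarrow> v \<and> T N (closest_point S v) = v"
    proof (rule inexact_iteration_converges[OF fP fT])
      show "T N (closest_point S (T N q)) = T N q" by (simp add: q)
      show "summable (\<lambda>k. err (k + N))" using err_summable by (simp add: summable_iff_shift)
      \<comment> \<open>From index \<open>N\<close> on the penalty is constant, so the single map
        \<open>T N\<close> serves as the exact step for every \<open>k\<close>.\<close>
      show "norm (y (Suc k + N) - T N (closest_point S (y (k + N)))) \<le> err (k + N)" for k
        using update[of "T N (yhat (k + N))" "k + N"] T'[of "yhat (k + N)"] by (simp add: muN yhat)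
    qed
    then obtain v where v: "(\<lambda>k. y (k + N)) \<longlonglongrightarrow> v" "T N (closest_point S v) = v" by blast
    have "y \<longlonglongrightarrow> v" using v(1) by (rule LIMSEQ_offset)
    moreover have "- v \<in> subdiff ?V (\<mu> *\<^sub>R (v - closest_point S v))"
      using T'[of "closest_point S v"] v(2) by simp
    then have "minimizer (\<lambda>v. - dual_fun f g c v + ereal (\<mu> / 2 * (infdist v S)\<^sup>2)) v"
      using S by (intro fixed_point_minimizes_dual[OF g(1) value_proper pos])
    ultimately show ?thesis by blast
  qed
  from part1 part2 show ?thesis by blast
qed

end
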